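(* Fix $\varepsilon\in(1/2,1)$ and $\alpha\in\mathbb{N}$. For $f\in\mathscr{H}_\alpha$ and every integer $n\geq 2$, with $T=\sqrt{\frac{2}{1-\varepsilon}\alpha\ln(n)}$, \[ |I(f)-Q_{n,T}^*(f\rho)|\leq C\|f\|_\alpha\frac{(\ln n)^{\alpha/2+1/4}}{n^\alpha}, \] where the constant $C$ is independent of $n$ and $f$ but depends on $\alpha$ and $\varepsilon$.
   Context: Let $\rho(x)=\frac{1}{\sqrt{2\pi}}\mathrm{e}^{-x^2/2}$ and $L^2_\rho$ the space of (equivalence classes of) measurable $f:\mathbb{R}\to\mathbb{R}$ with $\|f\|_{L^2_\rho}^2=\int_\mathbb{R}|f(x)|^2\rho(x)\,\mathrm{d}x<\infty$. For $\alpha\in\mathbb{N}$, the weighted Sobolev space $\mathscr{H}_\alpha$ is the set of $f\in L^2_\rho$ having weak derivatives $f^{(\tau)}\in L^2_\rho$ for $\tau=1,\dots,\alpha$, with norm $\|f\|_\alpha=(\sum_{\tau=0}^\alpha\|f^{(\tau)}\|_{L^2_\rho}^2)^{1/2}$; elements are identified with their continuous representatives. Let $I(f)=\int_\mathbb{R}f(x)\rho(x)\,\mathrm{d}x$. For $T>0$ and $n\in\mathbb{N}$, the trapezoidal rule is $Q_{n,T}^*(g)=\frac{2T}{n}\sum_{j=0}^{n-1}g(\xi_j^* )$ with $\xi_j^*=\frac{2T}{n}j-T$, $j=0,\dots,n-1$; here it is applied to $g=f\rho$. *)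

theory Defs
  imports "HOL-Analysis.Analysis"
begin

definition gauss_rho :: "real \<Rightarrow> real" where
  "gauss_rho x = exp (- (x^2) / 2) / sqrt (2 * pi)"

definition in_L2rho :: "(real \<Rightarrow> real) \<Rightarrow> bool" where
  "in_L2rho f \<longleftrightarrow> f \<in> borel_measurable borel \<and>
     integrable lborel (\<lambda>x. (f x)^2 * gauss_rho x)"

definition L2rho_norm :: "(real \<Rightarrow> real) \<Rightarrow> real" where
  "L2rho_norm f = sqrt (integral\<^sup>L lborel (\<lambda>x. (f x)^2 * gauss_rho x))"

definition test_fun :: "(real \<Rightarrow> real) \<Rightarrow> bool" where
  "test_fun \<phi> \<longleftrightarrow> (\<forall>k x. ((deriv ^^ k) \<phi>) differentiable (at x)) \<and>
     (\<exists>R. \<forall>x. \<bar>x\<bar> > R \<longrightarrow> \<phi> x = 0)"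

definition weak_deriv :: "nat \<Rightarrow> (real \<Rightarrow> real) \<Rightarrow> (real \<Rightarrow> real) \<Rightarrow> bool" where
  "weak_deriv \<tau> f g \<longleftrightarrow> (\<forall>\<phi>. test_fun \<phi> \<longrightarrow>
      integrable lborel (\<lambda>x. f x * (deriv ^^ \<tau>) \<phi> x) \<and>
      integrable lborel (\<lambda>x. g x * \<phi> x) \<and>
      integral\<^sup>L lborel (\<lambda>x. f x * (deriv ^^ \<tau>) \<phi> x)
        = (-1) ^ \<tau> * integral\<^sup>L lborel (\<lambda>x. g x * \<phi> x))"

definition sobolev_H :: "nat \<Rightarrow> (real \<Rightarrow> real) \<Rightarrow> (nat \<Rightarrow> real \<Rightarrow> real) \<Rightarrow> bool" where
  "sobolev_H \<alpha> f g \<longleftrightarrow> g 0 = f \<and> (\<forall>\<tau>\<le>\<alpha>. in_L2rho (g \<tau>)) \<and>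
     (\<forall>\<tau>\<in>{1..\<alpha>}. weak_deriv \<tau> f (g \<tau>))"

text \<open>The Sobolev norm ||f||_alpha, computed from the weak derivatives g.\<close>
definition sobolev_norm :: "nat \<Rightarrow> (nat \<Rightarrow> real \<Rightarrow> real) \<Rightarrow> real" where
  "sobolev_norm \<alpha> g = sqrt (\<Sum>\<tau>\<le>\<alpha>. (L2rho_norm (g \<tau>))^2)"

definition gauss_int :: "(real \<Rightarrow> real) \<Rightarrow> real" where
  "gauss_int f = integral\<^sup>L lborel (\<lambda>x. f x * gauss_rho x)"

definition trap_rule :: "nat \<Rightarrow> real \<Rightarrow> (real \<Rightarrow> real) \<Rightarrow> real" where
  "trap_rule n T g = 2 * T / real n * (\<Sum>j<n. g (2 * T / real n * real j - T))"

end

theory Submission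
  imports Defs "HOL-Probability.Distributions"
begin

text \<open>
  Let \<open>\<psi> = \<rho> \<chi>\<close> with a smooth cutoff \<open>\<chi>\<close> that is 1 on \<open>[-T, T]\<close> and 0 outside
  \<open>[-T-1, T+1]\<close>, and let \<open>h = 2T/n\<close>. Integrating a smooth approximation of
  \<open>1 - h \<Sum>\<^sub>j \<delta>(x - \<xi>\<^sub>j)\<close> \<open>\<alpha>\<close> times, each time with the periodic mean-zero primitive, gives a
  smooth \<open>\<phi>\<close> with \<open>\<bar>\<phi>\<bar> \<le> 2 h\<^sup>\<alpha>\<close>. Moving the \<open>\<alpha>\<close> derivatives of \<open>\<phi>\<close> onto \<open>f \<psi>\<close> bounds
  \<open>\<integral> f \<psi> - h \<Sum>\<^sub>j (f \<psi>)(\<xi>\<^sub>j)\<close>, summed over all nodes in the support of \<open>\<psi>\<close>, by a multiple of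
  \<open>\<parallel>f\<parallel>\<^sub>\<alpha> h\<^sup>\<alpha>\<close>. This uses only the definition of weak derivatives. The same
  argument with one derivative and a smooth step in place of \<open>\<phi>\<close> bounds \<open>f \<psi>\<close> pointwise at the
  nodes outside \<open>[-T, T)\<close>. There \<open>\<epsilon> > 1/2\<close> leaves room to split off
  \<open>exp (-(1-\<epsilon>) T\<^sup>2 / 2) = n\<^bsup>-\<alpha>\<^esup>\<close> from the Gaussian while keeping a factor
  \<open>exp (-\<beta> x\<^sup>2 / 2)\<close> with \<open>\<beta> = 1/4 + \<epsilon>/2 > 1/2\<close>, which is what the Cauchy-Schwarz inequality against
  \<open>L\<^sup>2\<^sub>\<rho>\<close> needs.
\<close>

subsection \<open>Smooth functions\<close>

text \<open>The smoothness clause of \<open>test_fun\<close> without compact support, so that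
  non-compactly supported kernels and cutoff factors can be treated alike.\<close>

definition smooth_fun :: "(real \<Rightarrow> real) \<Rightarrow> bool" where
  "smooth_fun u \<longleftrightarrow> (\<forall>k x. ((deriv ^^ k) u) differentiable (at x))"

text \<open>All iterates of \<open>deriv\<close> stay in \<open>S\<close>, whose members are
  differentiable. This acts as a coinduction principle: a family closed under differentiation
  replaces formulas for the k-th derivative.\<close>

lemma smooth_fun_closedI:
  assumes "u \<in> S"
    and S: "\<And>v. v \<in> S \<Longrightarrow> \<exists>w\<in>S. \<forall>x. (v has_real_derivative w x) (at x)"
  shows "smooth_fun u"
proof -
  have der: "deriv v \<in> S \<and> (\<forall>x. v differentiable (at x))" if vS: "v \<in> S" for v
  proof -
    obtain w where w: "w \<in> S" "\<And>x. (v has_real_derivative w x) (at x)"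
      using S[OF vS] by blast
    have "deriv v = w" by (rule ext) (rule DERIV_imp_deriv[OF w(2)])
    then show ?thesis using w real_differentiable_def by blast
  qed
  have "(deriv ^^ k) u \<in> S" for k
    by (induction k) (use assms(1) der in auto)
  then show ?thesis unfolding smooth_fun_def using der by blast
qed

lemma iter_deriv_shift: "(deriv ^^ k) (deriv u) = (deriv ^^ Suc k) u"
  by (simp only: funpow_Suc_right o_apply)

lemma smooth_fun_deriv: "smooth_fun u \<Longrightarrow> smooth_fun (deriv u)"
  unfolding smooth_fun_def iter_deriv_shift by blast

lemma smooth_fun_iter_deriv: "smooth_fun u \<Longrightarrow> smooth_fun ((deriv ^^ k) u)"
  by (induction k) (auto intro: smooth_fun_deriv)

lemma smooth_fun_DERIV: "smooth_fun u \<Longrightarrow> (u has_real_derivative deriv u x) (at x)"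
  unfolding DERIV_deriv_iff_real_differentiable smooth_fun_def by (drule spec[of _ 0]) simp

lemma smooth_fun_isCont: "smooth_fun u \<Longrightarrow> isCont u x"
  using smooth_fun_DERIV DERIV_isCont by blast

lemma smooth_fun_continuous_on: "smooth_fun u \<Longrightarrow> continuous_on A u"
  using smooth_fun_isCont continuous_at_imp_continuous_on by blast

lemma smooth_fun_antideriv:
  assumes "smooth_fun v" and "\<And>x. (u has_real_derivative v x) (at x)"
  shows "smooth_fun u"
proof (rule smooth_fun_closedI[where S = "insert u {v. smooth_fun v}"])
  fix w assume "w \<in> insert u {v. smooth_fun v}"
  then show "\<exists>w'\<in>insert u {v. smooth_fun v}. \<forall>x. (w has_real_derivative w' x) (at x)"
  proof (cases "w = u")
    case True
    then show ?thesis using assms by (intro bexI[of _ v]) auto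
  next
    case False
    with \<open>w \<in> _\<close> have "smooth_fun w" by simp
    then show ?thesis
      by (intro bexI[of _ "deriv w"]) (auto intro: smooth_fun_deriv smooth_fun_DERIV)
  qed
qed simp

text \<open>
  By construction this set contains a derivative of each of its elements, so
  \<open>smooth_fun_closedI\<close> yields closure of smoothness under all these operations at once.
\<close>
inductive_set smooth_alg :: "(real \<Rightarrow> real) set" where
  base: "smooth_fun u \<Longrightarrow> u \<in> smooth_alg"
| comp: "smooth_fun v \<Longrightarrow> smooth_fun c \<Longrightarrow> (\<lambda>x. v (c x)) \<in> smooth_alg"
| inv: "smooth_fun v \<Longrightarrow> (\<And>x. v x \<noteq> 0) \<Longrightarrow> (\<lambda>x. inverse (v x)) \<in> smooth_alg"
| add: "u \<in> smooth_alg \<Longrightarrow> v \<in> smooth_alg \<Longrightarrow> (\<lambda>x. u x + v x) \<in> smooth_alg"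
| mult: "u \<in> smooth_alg \<Longrightarrow> v \<in> smooth_alg \<Longrightarrow> (\<lambda>x. u x * v x) \<in> smooth_alg"

lemma smooth_fun_const [simp]: "smooth_fun (\<lambda>_. c)"
proof (rule smooth_fun_closedI[where S = "range (\<lambda>c _. c)"])
  fix v :: "real \<Rightarrow> real" assume "v \<in> range (\<lambda>c _. c)"
  then show "\<exists>w\<in>range (\<lambda>c _. c). \<forall>x. (v has_real_derivative w x) (at x)"
    by (intro bexI[of _ "\<lambda>_. 0"]) auto
qed simp

lemma smooth_fun_ident [simp]: "smooth_fun (\<lambda>x. x)"
  by (rule smooth_fun_antideriv[where v = "\<lambda>_. 1"]) auto

lemma smooth_alg_smooth:
  assumes "u \<in> smooth_alg" shows "smooth_fun u"
proof (rule smooth_fun_closedI[OF assms])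
  fix w assume "w \<in> smooth_alg"
  then show "\<exists>w'\<in>smooth_alg. \<forall>x. (w has_real_derivative w' x) (at x)"
  proof induction
    case (base u)
    then show ?case
      by (intro bexI[of _ "deriv u"] allI smooth_fun_DERIV smooth_alg.base smooth_fun_deriv)
  next
    case (comp v c)
    have "(\<lambda>x. deriv v (c x) * deriv c x) \<in> smooth_alg"
      by (intro smooth_alg.mult smooth_alg.comp smooth_alg.base smooth_fun_deriv comp)
    moreover have "((\<lambda>x. v (c x)) has_real_derivative deriv v (c x) * deriv c x) (at x)" for x
      using DERIV_chain2[OF smooth_fun_DERIV[OF comp(1)] smooth_fun_DERIV[OF comp(2)]] .
    ultimately show ?case by (intro bexI allI)
  next
    case (inv v)
    have "(\<lambda>x. (-1) * (deriv v x * (inverse (v x) * inverse (v x)))) \<in> smooth_alg"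
      by (intro smooth_alg.mult smooth_alg.inv smooth_alg.base)
         (use inv smooth_fun_deriv in auto)
    moreover have "((\<lambda>x. inverse (v x)) has_real_derivative
        (-1) * (deriv v x * (inverse (v x) * inverse (v x)))) (at x)" for x
      using DERIV_inverse'[OF smooth_fun_DERIV[OF inv(1)] inv(2), of x] by (simp add: mult_ac)
    ultimately show ?case by (intro bexI allI)
  next
    case (add u v)
    then obtain u' v' where *: "u' \<in> smooth_alg" "v' \<in> smooth_alg"
      "\<And>x. (u has_real_derivative u' x) (at x)" "\<And>x. (v has_real_derivative v' x) (at x)" by blast
    have "(\<lambda>x. u' x + v' x) \<in> smooth_alg" by (intro smooth_alg.add *)
    moreover have "((\<lambda>x. u x + v x) has_real_derivative u' x + v' x) (at x)" for x
      by (intro DERIV_add *)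
    ultimately show ?case by (intro bexI allI)
  next
    case (mult u v)
    then obtain u' v' where *: "u' \<in> smooth_alg" "v' \<in> smooth_alg"
      "\<And>x. (u has_real_derivative u' x) (at x)" "\<And>x. (v has_real_derivative v' x) (at x)" by blast
    have "(\<lambda>x. u' x * v x + v' x * u x) \<in> smooth_alg"
      by (intro smooth_alg.add smooth_alg.mult * mult)
    moreover have "((\<lambda>x. u x * v x) has_real_derivative u' x * v x + v' x * u x) (at x)" for x
      by (intro DERIV_mult *)
    ultimately show ?case by (intro bexI allI)
  qed
qed

lemma smooth_fun_add: "smooth_fun u \<Longrightarrow> smooth_fun v \<Longrightarrow> smooth_fun (\<lambda>x. u x + v x)"
  by (rule smooth_alg_smooth[OF smooth_alg.add[OF smooth_alg.base smooth_alg.base]])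

lemma smooth_fun_mult: "smooth_fun u \<Longrightarrow> smooth_fun v \<Longrightarrow> smooth_fun (\<lambda>x. u x * v x)"
  by (rule smooth_alg_smooth[OF smooth_alg.mult[OF smooth_alg.base smooth_alg.base]])

lemma smooth_fun_compose: "smooth_fun v \<Longrightarrow> smooth_fun c \<Longrightarrow> smooth_fun (\<lambda>x. v (c x))"
  by (rule smooth_alg_smooth[OF smooth_alg.comp])

lemma smooth_fun_inverse: "smooth_fun v \<Longrightarrow> (\<And>x. v x \<noteq> 0) \<Longrightarrow> smooth_fun (\<lambda>x. inverse (v x))"
  by (rule smooth_alg_smooth[OF smooth_alg.inv])

lemma smooth_fun_affine: "smooth_fun (\<lambda>x. a * x + b)"
  by (intro smooth_fun_add smooth_fun_mult) simp_all

section \<open>Calculus of iterated derivatives\<close>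

lemma iter_deriv_eqI:
  assumes "\<And>k x. (D k has_real_derivative D (Suc k) x) (at x)"
  shows "(deriv ^^ k) (D 0) = D k"
proof (induction k)
  case (Suc k)
  have "deriv (D k) = D (Suc k)" by (rule ext) (rule DERIV_imp_deriv[OF assms])
  with Suc show ?case by simp
qed simp

lemma smooth_fun_iter_DERIV:
  "smooth_fun u \<Longrightarrow> ((deriv ^^ k) u has_real_derivative (deriv ^^ Suc k) u x) (at x)"
  using smooth_fun_DERIV[OF smooth_fun_iter_deriv] by simp

lemma iter_deriv_add:
  assumes "smooth_fun u" "smooth_fun v"
  shows "(deriv ^^ k) (\<lambda>x. u x + v x) = (\<lambda>x. (deriv ^^ k) u x + (deriv ^^ k) v x)"
  using iter_deriv_eqI[of "\<lambda>k x. (deriv ^^ k) u x + (deriv ^^ k) v x"]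
    DERIV_add[OF smooth_fun_iter_DERIV[OF assms(1)] smooth_fun_iter_DERIV[OF assms(2)]]
  by simp

lemma iter_deriv_affine:
  assumes "smooth_fun u"
  shows "(deriv ^^ k) (\<lambda>x. c * u (a * x + b)) = (\<lambda>x. c * a ^ k * (deriv ^^ k) u (a * x + b))"
proof -
  have "((\<lambda>x. c * a ^ k * (deriv ^^ k) u (a * x + b)) has_real_derivative
      c * a ^ Suc k * (deriv ^^ Suc k) u (a * x + b)) (at x)" for k x
  proof -
    have "((\<lambda>x. a * x + b) has_real_derivative a) (at x)" by (auto intro!: derivative_eq_intros)
    from DERIV_cmult[OF DERIV_chain2[OF smooth_fun_iter_DERIV[OF assms] this], of "c * a ^ k"]
    show ?thesis by (simp add: mult_ac)
  qed
  from iter_deriv_eqI[of "\<lambda>k x. c * a ^ k * (deriv ^^ k) u (a * x + b)", OF this]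
  show ?thesis by simp
qed

lemma deriv_mult_smooth:
  assumes "smooth_fun u" "smooth_fun v"
  shows "deriv (\<lambda>x. u x * v x) = (\<lambda>x. deriv u x * v x + u x * deriv v x)"
proof
  fix x show "deriv (\<lambda>x. u x * v x) x = deriv u x * v x + u x * deriv v x"
    using DERIV_imp_deriv[OF DERIV_mult[OF smooth_fun_DERIV[OF assms(1)] smooth_fun_DERIV[OF assms(2)], of x]]
    by (simp add: mult_ac)
qed

text \<open>A Leibniz bound without binomial coefficients: each differentiation turns a product into
  two, so order \<open>k\<close> yields \<open>2 ^ k\<close> products, each at most
  \<open>A * B\<close>.\<close>

lemma iter_deriv_mult_bound:
  assumes "smooth_fun u" "smooth_fun v"
    and "\<And>j. j \<le> k \<Longrightarrow> \<bar>(deriv ^^ j) u x\<bar> \<le> A"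
    and "\<And>j. j \<le> k \<Longrightarrow> \<bar>(deriv ^^ j) v x\<bar> \<le> B"
  shows "\<bar>(deriv ^^ k) (\<lambda>x. u x * v x) x\<bar> \<le> 2 ^ k * A * B"
  using assms
proof (induction k arbitrary: u v)
  case 0
  have "\<bar>u x\<bar> * \<bar>v x\<bar> \<le> A * B"
    using 0(3)[of 0] 0(4)[of 0] by (intro mult_mono) auto
  then show ?case by (simp add: abs_mult)
next
  case (Suc k)
  note d = smooth_fun_deriv[OF Suc.prems(1)] smooth_fun_deriv[OF Suc.prems(2)]
  have "(deriv ^^ Suc k) (\<lambda>x. u x * v x) = (deriv ^^ k) (\<lambda>x. deriv u x * v x + u x * deriv v x)"
    unfolding iter_deriv_shift[symmetric] deriv_mult_smooth[OF Suc.prems(1,2)] ..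
  also have "\<dots> = (\<lambda>x. (deriv ^^ k) (\<lambda>x. deriv u x * v x) x + (deriv ^^ k) (\<lambda>x. u x * deriv v x) x)"
    by (intro iter_deriv_add smooth_fun_mult d Suc.prems)
  finally have eq: "(deriv ^^ Suc k) (\<lambda>x. u x * v x) x
      = (deriv ^^ k) (\<lambda>x. deriv u x * v x) x + (deriv ^^ k) (\<lambda>x. u x * deriv v x) x" by simp
  have "\<bar>(deriv ^^ k) (\<lambda>x. deriv u x * v x) x\<bar> \<le> 2 ^ k * A * B"
  proof (rule Suc.IH[OF d(1) Suc.prems(2)])
    fix j assume "j \<le> k"
    then show "\<bar>(deriv ^^ j) (deriv u) x\<bar> \<le> A" "\<bar>(deriv ^^ j) v x\<bar> \<le> B"
      using Suc.prems(3)[of "Suc j"] Suc.prems(4)[of j] unfolding iter_deriv_shift by auto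
  qed
  moreover have "\<bar>(deriv ^^ k) (\<lambda>x. u x * deriv v x) x\<bar> \<le> 2 ^ k * A * B"
  proof (rule Suc.IH[OF Suc.prems(1) d(2)])
    fix j assume "j \<le> k"
    then show "\<bar>(deriv ^^ j) (deriv v) x\<bar> \<le> B" "\<bar>(deriv ^^ j) u x\<bar> \<le> A"
      using Suc.prems(4)[of "Suc j"] Suc.prems(3)[of j] unfolding iter_deriv_shift by auto
  qed
  ultimately show ?case unfolding eq by (simp add: abs_le_iff)
qed

text \<open>Differentiation is local, so on an open set \<open>u\<close> may be replaced by the zero
  function at every order.\<close>

lemma iter_deriv_eq_0_on_open:
  fixes u :: "real \<Rightarrow> real"
  assumes "open X" "\<And>x. x \<in> X \<Longrightarrow> u x = 0" "x \<in> X"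
  shows "(deriv ^^ k) u x = 0"
  using assms(3)
proof (induction k arbitrary: x)
  case (Suc k)
  have "((deriv ^^ k) u has_real_derivative 0) (at x)"
    by (rule has_field_derivative_transform_within_open[OF DERIV_const \<open>open X\<close> Suc.prems])
       (simp add: Suc.IH)
  then show ?case using DERIV_imp_deriv by simp
qed (use assms in simp)

subsection \<open>A smooth step\<close>

text \<open>The classical smooth, non-analytic function all of whose derivatives vanish at
  0.\<close>

definition flat_exp :: "real \<Rightarrow> real" where
  "flat_exp x = (if x > 0 then exp (- 1 / x) else 0)"

lemma tendsto_poly_div_exp_0: "((\<lambda>x::real. poly p x / exp x) \<longlongrightarrow> 0) at_top"
proof -
  have "((\<lambda>x::real. \<Sum>i\<le>degree p. coeff p i * (x ^ i / exp x)) \<longlongrightarrow> (\<Sum>i\<le>degree p. coeff p i * 0)) at_top"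
    by (intro tendsto_sum tendsto_mult tendsto_const tendsto_power_div_exp_0)
  then show ?thesis by (simp add: poly_altdef sum_divide_distrib)
qed

text \<open>The functions p(1/x) exp(-1/x), extended by 0 to x \<le> 0, form a family closed under
  differentiation; at 0 this rests on the exponential beating every polynomial.\<close>

lemma smooth_fun_flat_exp: "smooth_fun flat_exp"
proof (rule smooth_fun_closedI)
  let ?e = "\<lambda>(p::real poly) x. if x > (0::real) then poly p (1 / x) * exp (- 1 / x) else 0"
  have "flat_exp = ?e 1" by (auto simp: flat_exp_def)
  then show "flat_exp \<in> range ?e" by blast
  fix v assume "v \<in> range ?e"
  then obtain p where v: "v = ?e p" by blast
  \<comment> \<open>With y = 1/x, d/dx is -y^2 d/dy, and the y-derivative of p(y) exp(-y) is (p'(y)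
    - p(y)) exp(-y).\<close>
  define r where "r = [:0, 0, 1:] * (p - pderiv p)"
  have "(?e p has_real_derivative ?e r x) (at x)" for x
  proof -
    consider "x > 0" | "x < 0" | "x = 0" by linarith
    then show ?thesis
    proof cases
      case 1
      have "((\<lambda>x. poly p (1 / x) * exp (- 1 / x)) has_real_derivative ?e r x) (at x)"
        by (rule derivative_eq_intros DERIV_chain2[OF poly_DERIV] refl | use 1 in \<open>simp; fail\<close>)+
           (use 1 in \<open>simp add: r_def field_simps power2_eq_square\<close>)
      then show ?thesis
        by (rule has_field_derivative_transform_within_open[where S = "{0<..}"]) (use 1 in auto)
    next
      case 2
      show ?thesis
        by (rule has_field_derivative_transform_within_open[where S = "{..<0}" and f = "\<lambda>_. 0"])
           (use 2 in auto)
    next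
      case 3
      \<comment> \<open>With y = 1/h the right difference quotient at 0 is y p(y) exp(-y), and
        \<open>pCons 0 p\<close> is the polynomial y p(y).\<close>
      have "((\<lambda>h. poly (pCons 0 p) (inverse h) / exp (inverse h)) \<longlongrightarrow> 0) (at_right 0)"
        by (rule filterlim_compose[OF tendsto_poly_div_exp_0 filterlim_inverse_at_top_right])
      then have "((\<lambda>h. (?e p h - ?e p 0) / (h - 0)) \<longlongrightarrow> 0) (at_right 0)"
        by (rule Lim_transform_eventually)
           (auto simp: eventually_at_filter field_simps exp_minus)
      moreover have "((\<lambda>h. (?e p h - ?e p 0) / (h - 0)) \<longlongrightarrow> 0) (at_left 0)"
        by (rule Lim_transform_eventually[OF tendsto_const]) (auto simp: eventually_at_filter)
      ultimately have "((\<lambda>h. (?e p h - ?e p 0) / (h - 0)) \<longlongrightarrow> 0) (at 0)"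
        by (simp only: filterlim_split_at)
      then show ?thesis unfolding 3 by (simp add: has_field_derivative_iff)
    qed
  qed
  then show "\<exists>w\<in>range ?e. \<forall>x. (v has_real_derivative w x) (at x)"
    unfolding v by (intro bexI[of _ "?e r"] allI rangeI)
qed

definition smooth_step :: "real \<Rightarrow> real" where
  "smooth_step x = flat_exp x * inverse (flat_exp x + flat_exp (1 - x))"

lemma flat_exp_nonneg: "flat_exp x \<ge> 0" by (simp add: flat_exp_def)

text \<open>At least one of \<open>x\<close> and \<open>1 - x\<close> is positive. This makes the
  denominator of \<open>smooth_step\<close> invertible everywhere.\<close>

lemma flat_exp_sum_pos: "flat_exp x + flat_exp (1 - x) > 0"
  by (cases "x > 0") (auto simp: flat_exp_def add_pos_nonneg add_nonneg_pos)

lemma smooth_fun_smooth_step: "smooth_fun smooth_step"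
proof -
  have "smooth_fun (\<lambda>x. flat_exp (1 - x))"
    using smooth_fun_compose[OF smooth_fun_flat_exp smooth_fun_affine[of "-1" 1]] by simp
  then have "smooth_fun (\<lambda>x. flat_exp x * inverse (flat_exp x + flat_exp (1 - x)))"
    using flat_exp_sum_pos
    by (intro smooth_fun_mult smooth_fun_inverse smooth_fun_add smooth_fun_flat_exp)
       (auto simp: less_imp_neq[symmetric])
  then show ?thesis by (simp add: smooth_step_def[abs_def])
qed

lemma smooth_step_eq_0: "x \<le> 0 \<Longrightarrow> smooth_step x = 0"
  by (simp add: smooth_step_def flat_exp_def)

lemma smooth_step_eq_1: "x \<ge> 1 \<Longrightarrow> smooth_step x = 1"
  by (simp add: smooth_step_def flat_exp_def)

lemma smooth_step_bounds: "0 \<le> smooth_step x" "smooth_step x \<le> 1"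
  using flat_exp_nonneg[of x] flat_exp_nonneg[of "1 - x"] flat_exp_sum_pos[of x]
  by (auto simp: smooth_step_def field_simps)

lemma iter_deriv_smooth_step_eq_0:
  assumes "k > 0" "x < 0 \<or> x > 1"
  shows "(deriv ^^ k) smooth_step x = 0"
proof -
  obtain j where k: "k = Suc j" using assms gr0_implies_Suc by blast
  have "deriv smooth_step y = 0" if "y \<in> {..<0} \<union> {1<..}" for y
  proof (rule DERIV_imp_deriv)
    show "(smooth_step has_real_derivative 0) (at y)"
    proof (cases "y < 0")
      case True
      show ?thesis
        by (rule has_field_derivative_transform_within_open[where S = "{..<0}" and f = "\<lambda>_. 0"])
           (use True smooth_step_eq_0 in auto)
    next
      case False
      show ?thesis
        by (rule has_field_derivative_transform_within_open[where S = "{1<..}" and f = "\<lambda>_. 1"])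
           (use False that smooth_step_eq_1 in auto)
    qed
  qed
  then have "(deriv ^^ j) (deriv smooth_step) x = 0"
    by (intro iter_deriv_eq_0_on_open[where X = "{..<0} \<union> {1<..}"]) (use assms(2) in auto)
  then show ?thesis by (simp add: k funpow_swap1)
qed

lemma continuous_on_Icc_abs_bounded:
  fixes u :: "real \<Rightarrow> real"
  assumes "continuous_on {a..b} u"
  shows "\<exists>B. \<forall>x\<in>{a..b}. \<bar>u x\<bar> \<le> B"
  using compact_imp_bounded[OF compact_continuous_image[OF assms compact_Icc]]
  by (simp add: bounded_iff)

text \<open>Order 0 lies between 0 and 1; a derivative of positive order is continuous and vanishes
  off the compact interval \<open>{0..1}\<close>.\<close>

lemma iter_deriv_smooth_step_bounded: "\<exists>B. \<forall>x. \<bar>(deriv ^^ k) smooth_step x\<bar> \<le> B"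
proof (cases "k = 0")
  case True
  then show ?thesis using smooth_step_bounds by (intro exI[of _ 1]) (auto simp: abs_le_iff)
next
  case False
  obtain B where B: "\<forall>x\<in>{0..1}. \<bar>(deriv ^^ k) smooth_step x\<bar> \<le> B"
    using continuous_on_Icc_abs_bounded[OF smooth_fun_continuous_on[OF
          smooth_fun_iter_deriv[OF smooth_fun_smooth_step]]] by blast
  have "\<bar>(deriv ^^ k) smooth_step x\<bar> \<le> max B 0" for x
    using bspec[OF B, of x] iter_deriv_smooth_step_eq_0[of k x] False by (cases "x \<in> {0..1}") auto
  then show ?thesis by blast
qed

lemma iter_derivs_smooth_step_bounded: "\<exists>B\<ge>0. \<forall>j\<le>k. \<forall>x. \<bar>(deriv ^^ j) smooth_step x\<bar> \<le> B"
proof -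
  obtain b where b: "\<And>j x. \<bar>(deriv ^^ j) smooth_step x\<bar> \<le> b j"
    using iter_deriv_smooth_step_bounded by metis
  have "\<bar>(deriv ^^ j) smooth_step x\<bar> \<le> (\<Sum>j\<le>k. \<bar>b j\<bar>)" if "j \<le> k" for j x
  proof -
    have "\<bar>b j\<bar> \<le> (\<Sum>j\<le>k. \<bar>b j\<bar>)" using that by (intro member_le_sum) auto
    then show ?thesis using b[of j x] by linarith
  qed
  then show ?thesis by (intro exI[of _ "\<Sum>j\<le>k. \<bar>b j\<bar>"]) (auto intro: sum_nonneg)
qed

subsection \<open>Gaussian weights and weak derivatives\<close>

lemma gauss_rho_pos: "gauss_rho x > 0"
  by (simp add: gauss_rho_def)

lemma gauss_rho_le_exp: "gauss_rho x \<le> exp (- (x\<^sup>2) / 2)"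
proof -
  have "sqrt (2 * pi) \<ge> 1" using pi_gt3 by simp
  then show ?thesis by (simp add: gauss_rho_def divide_le_eq mult_le_cancel_left1)
qed

lemma integrable_exp_neg_square:
  assumes "c > 0"
  shows "integrable lborel (\<lambda>x::real. exp (- (c * x\<^sup>2)))"
proof -
  let ?s = "sqrt (1 / (2 * c))"
  have "sqrt (2 * pi * ?s\<^sup>2) * normal_density 0 ?s x = exp (- (c * x\<^sup>2))" for x
    using assms by (simp add: normal_density_def)
  moreover have "integrable lborel (\<lambda>x. sqrt (2 * pi * ?s\<^sup>2) * normal_density 0 ?s x)"
    using assms by (intro integrable_mult_right integrable_normal_density) auto
  ultimately show ?thesis by simp
qed

text \<open>The norm of \<open>exp (- (\<beta> * x\<^sup>2) / 2)\<close> in L^2 with weight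
  1/\<rho>, which is dual to the weight \<rho> in the Cauchy-Schwarz inequality.\<close>

definition gauss_const :: "real \<Rightarrow> real" where
  "gauss_const \<beta> = sqrt (integral\<^sup>L lborel (\<lambda>x. exp (- (\<beta> * x\<^sup>2)) / gauss_rho x))"

lemma gauss_const_nonneg: "gauss_const \<beta> \<ge> 0"
  by (auto simp: gauss_const_def intro!: integral_nonneg_AE AE_I2 divide_nonneg_pos gauss_rho_pos)

lemma L2rho_norm_nonneg: "L2rho_norm g \<ge> 0"
  by (auto simp: L2rho_norm_def intro!: integral_nonneg_AE AE_I2 mult_nonneg_nonneg
          less_imp_le[OF gauss_rho_pos])

text \<open>For positive \<open>a\<close> and \<open>b\<close> the right-hand side at t = b/a equals
  \<open>a * b\<close>. This turns a family of Young inequalities into Cauchy-Schwarz.\<close>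

lemma le_mult_of_le_weighted_squares:
  fixes a b X :: real
  assumes "a \<ge> 0" "b \<ge> 0" and X: "\<And>t. t > 0 \<Longrightarrow> X \<le> (t * a\<^sup>2 + b\<^sup>2 / t) / 2"
  shows "X \<le> a * b"
proof (rule tendsto_lowerbound)
  show "((\<lambda>e. (a + e) * (b + e)) \<longlongrightarrow> a * b) (at_right 0)"
    by (auto intro!: tendsto_eq_intros)
  have "X \<le> (a + e) * (b + e)" if "e > 0" for e
  proof -
    have pos: "a + e > 0" "b + e > 0" using assms(1,2) that by auto
    \<comment> \<open>Shifting both numbers by \<open>e\<close> keeps the optimal \<open>t\<close>
      well defined and positive even if \<open>a\<close> or \<open>b\<close> is 0; then
      \<open>e\<close> tends to 0.\<close>
    define t where "t = (b + e) / (a + e)"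
    have t: "t > 0" using pos by (simp add: t_def)
    have "t * a\<^sup>2 \<le> t * (a + e)\<^sup>2"
      using t assms that by (intro mult_left_mono power_mono) auto
    moreover have "b\<^sup>2 / t \<le> (b + e)\<^sup>2 / t"
      using t assms that by (intro divide_right_mono power_mono) auto
    moreover have "t * (a + e)\<^sup>2 = (a + e) * (b + e)" "(b + e)\<^sup>2 / t = (a + e) * (b + e)"
      using pos by (auto simp: power2_eq_square t_def)
    ultimately show ?thesis using X[OF t] by argo
  qed
  then show "\<forall>\<^sub>F e in at_right 0. X \<le> (a + e) * (b + e)"
    by (auto simp: eventually_at_filter)
qed simp

text \<open>Cauchy-Schwarz for the product of g \<rho>^(1/2) and \<psi> \<rho>^(-1/2). A pointwise
  Young inequality with parameter \<open>t\<close> gives integrability at t = 1, and the norm bound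
  after integrating and optimising in \<open>t\<close>.\<close>

lemma L2rho_gauss_bound:
  assumes "\<beta> > 1/2" and g: "in_L2rho g" and [measurable]: "\<psi> \<in> borel_measurable borel"
    and bd: "\<And>x. \<bar>\<psi> x\<bar> \<le> K * exp (- (\<beta> * x\<^sup>2) / 2)"
  shows "integrable lborel (\<lambda>x. g x * \<psi> x)"
    and "\<bar>integral\<^sup>L lborel (\<lambda>x. g x * \<psi> x)\<bar> \<le> K * gauss_const \<beta> * L2rho_norm g"
proof -
  let ?W = "\<lambda>x. exp (- (\<beta> * x\<^sup>2)) / gauss_rho x" and ?G = "\<lambda>x. (g x)\<^sup>2 * gauss_rho x"
  have [measurable]: "g \<in> borel_measurable borel" and G: "integrable lborel ?G"
    using g by (auto simp: in_L2rho_def)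
  have K: "K \<ge> 0" using bd[of 0] by simp
  \<comment> \<open>Dividing by the density costs half of the exponent; what remains decays because
    \<beta> > 1/2.\<close>
  have "?W = (\<lambda>x. sqrt (2 * pi) * exp (- ((\<beta> - 1/2) * x\<^sup>2)))"
    by (auto simp: gauss_rho_def field_simps simp flip: exp_add)
  then have W: "integrable lborel ?W"
    using integrable_exp_neg_square[of "\<beta> - 1/2"] assms(1) by simp
  \<comment> \<open>Expand the square of \<open>t * ?r * ?a - ?b\<close> and divide by
    \<open>t * ?r\<close>.\<close>
  have key: "\<bar>g x * \<psi> x\<bar> \<le> (t * ?G x + K\<^sup>2 * ?W x / t) / 2" if "t > 0" for t x
  proof -
    let ?r = "gauss_rho x" and ?a = "\<bar>g x\<bar>" and ?b = "\<bar>\<psi> x\<bar>"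
    have r: "?r > 0" by (rule gauss_rho_pos)
    have "?b\<^sup>2 \<le> (K * exp (- (\<beta> * x\<^sup>2) / 2))\<^sup>2" using bd[of x] by (intro power_mono) auto
    also have "\<dots> = K\<^sup>2 * exp (- (\<beta> * x\<^sup>2))"
      by (simp add: power_mult_distrib flip: exp_of_nat_mult)
    finally have b: "?b\<^sup>2 \<le> K\<^sup>2 * exp (- (\<beta> * x\<^sup>2))" .
    have "0 \<le> (t * ?r * ?a - ?b)\<^sup>2" by simp
    then have "2 * (t * ?r * (?a * ?b)) \<le> (t * ?r * ?a)\<^sup>2 + ?b\<^sup>2"
      by (simp add: power2_diff algebra_simps)
    also have "\<dots> \<le> (t * ?r * ?a)\<^sup>2 + K\<^sup>2 * exp (- (\<beta> * x\<^sup>2))" using b by simp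
    also have "\<dots> = (t * ?r) * (t * ?G x + K\<^sup>2 * ?W x / t)"
      using r that by (simp add: field_simps power2_eq_square)
    finally have "(t * ?r) * (2 * (?a * ?b)) \<le> (t * ?r) * (t * ?G x + K\<^sup>2 * ?W x / t)"
      by (simp add: mult_ac)
    then have "2 * (?a * ?b) \<le> t * ?G x + K\<^sup>2 * ?W x / t"
      using r that by (subst (asm) mult_le_cancel_left_pos) auto
    then show ?thesis by (simp add: abs_mult)
  qed
  have dom: "integrable lborel (\<lambda>x. (t * ?G x + K\<^sup>2 * ?W x / t) / 2)" for t
    using G W by (intro Bochner_Integration.integrable_divide Bochner_Integration.integrable_add
        integrable_mult_right) auto
  show int: "integrable lborel (\<lambda>x. g x * \<psi> x)"
    by (rule Bochner_Integration.integrable_bound[OF dom[of 1]])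
       (use key[of 1] in \<open>auto simp: abs_le_iff intro!: AE_I2 order_trans[OF _ abs_ge_self]\<close>)
  have "\<bar>integral\<^sup>L lborel (\<lambda>x. g x * \<psi> x)\<bar> \<le> L2rho_norm g * (K * gauss_const \<beta>)"
  proof (rule le_mult_of_le_weighted_squares)
    show "0 \<le> L2rho_norm g" by (rule L2rho_norm_nonneg)
    show "0 \<le> K * gauss_const \<beta>" using K gauss_const_nonneg by simp
    fix t :: real assume t: "t > 0"
    have "\<bar>integral\<^sup>L lborel (\<lambda>x. g x * \<psi> x)\<bar> \<le> integral\<^sup>L lborel (\<lambda>x. \<bar>g x * \<psi> x\<bar>)"
      by (rule integral_abs_bound)
    also have "\<dots> \<le> integral\<^sup>L lborel (\<lambda>x. (t * ?G x + K\<^sup>2 * ?W x / t) / 2)"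
      using int dom key[OF t] by (intro integral_mono) auto
    also have "\<dots> = integral\<^sup>L lborel (\<lambda>x. t / 2 * ?G x + K\<^sup>2 / (2 * t) * ?W x)"
      by (intro Bochner_Integration.integral_cong) (auto simp: field_simps)
    also have "\<dots> = t / 2 * integral\<^sup>L lborel ?G + K\<^sup>2 / (2 * t) * integral\<^sup>L lborel ?W"
      by (subst Bochner_Integration.integral_add[OF integrable_mult_right[OF G] integrable_mult_right[OF W]])
         (simp only: integral_mult_right_zero)
    also have "\<dots> = (t * integral\<^sup>L lborel ?G + K\<^sup>2 * integral\<^sup>L lborel ?W / t) / 2"
      using t by (simp add: field_simps)
    also have "integral\<^sup>L lborel ?G = (L2rho_norm g)\<^sup>2"
      by (auto simp: L2rho_norm_def intro!: integral_nonneg_AE AE_I2 mult_nonneg_nonneg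
          less_imp_le[OF gauss_rho_pos] real_sqrt_pow2[symmetric])
    also have "K\<^sup>2 * integral\<^sup>L lborel ?W = (K * gauss_const \<beta>)\<^sup>2"
      unfolding gauss_const_def power_mult_distrib
      by (subst real_sqrt_pow2) (auto intro!: integral_nonneg_AE AE_I2 divide_nonneg_pos gauss_rho_pos)
    finally show "\<bar>integral\<^sup>L lborel (\<lambda>x. g x * \<psi> x)\<bar>
        \<le> (t * (L2rho_norm g)\<^sup>2 + (K * gauss_const \<beta>)\<^sup>2 / t) / 2" .
  qed
  then show "\<bar>integral\<^sup>L lborel (\<lambda>x. g x * \<psi> x)\<bar> \<le> K * gauss_const \<beta> * L2rho_norm g"
    by (simp add: mult_ac)
qed

lemma L2rho_norm_le_sobolev_norm: "i \<le> \<alpha> \<Longrightarrow> L2rho_norm (g i) \<le> sobolev_norm \<alpha> g"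
  unfolding sobolev_norm_def
  by (intro real_le_rsqrt member_le_sum[where f = "\<lambda>i. (L2rho_norm (g i))\<^sup>2"]) auto

lemma sobolev_norm_nonneg: "sobolev_norm \<alpha> g \<ge> 0"
  by (simp add: sobolev_norm_def sum_nonneg)

section \<open>Test functions and integration by parts\<close>

lemma test_fun_iff:
  "test_fun \<phi> \<longleftrightarrow> smooth_fun \<phi> \<and> (\<exists>R. \<forall>x. \<bar>x\<bar> > R \<longrightarrow> \<phi> x = 0)"
  by (simp add: test_fun_def smooth_fun_def)

lemma test_fun_deriv:
  assumes "test_fun \<phi>" shows "test_fun (deriv \<phi>)"
proof -
  obtain R where R: "\<And>x. \<bar>x\<bar> > R \<Longrightarrow> \<phi> x = 0" and s: "smooth_fun \<phi>"
    using assms by (auto simp: test_fun_iff)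
  have "open {x::real. \<bar>x\<bar> > R}" by (intro open_Collect_less continuous_intros)
  then have "deriv \<phi> x = 0" if "\<bar>x\<bar> > R" for x
    using iter_deriv_eq_0_on_open[of "{x. \<bar>x\<bar> > R}" \<phi> x 1] R that by simp
  then show ?thesis using s smooth_fun_deriv by (auto simp: test_fun_iff)
qed

lemma test_fun_mult:
  assumes "test_fun \<psi>" "smooth_fun \<phi>" shows "test_fun (\<lambda>x. \<psi> x * \<phi> x)"
  using assms smooth_fun_mult by (fastforce simp: test_fun_iff)

lemma smooth_fun_measurable: "smooth_fun u \<Longrightarrow> u \<in> borel_measurable borel"
  using smooth_fun_continuous_on borel_measurable_continuous_onI by blast

text \<open>On the compact support the continuous function
  \<open>\<phi> x * exp (x\<^sup>2 / 2)\<close> is bounded. This puts test functions under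
  \<open>L2rho_gauss_bound\<close> with \<beta> = 1.\<close>

lemma test_fun_le_gauss:
  assumes "test_fun \<phi>"
  shows "\<exists>B. \<forall>x. \<bar>\<phi> x\<bar> \<le> B * exp (- (x\<^sup>2) / 2)"
proof -
  obtain R where R: "\<And>x. \<bar>x\<bar> > R \<Longrightarrow> \<phi> x = 0" and s: "smooth_fun \<phi>"
    using assms by (auto simp: test_fun_iff)
  have "continuous_on {-R..R} (\<lambda>x. \<phi> x * exp (x\<^sup>2 / 2))"
    by (intro continuous_intros smooth_fun_continuous_on s) auto
  then obtain B where B: "\<forall>x\<in>{-R..R}. \<bar>\<phi> x * exp (x\<^sup>2 / 2)\<bar> \<le> B"
    using continuous_on_Icc_abs_bounded by blast
  have "\<bar>\<phi> x\<bar> \<le> max B 0 * exp (- (x\<^sup>2) / 2)" for x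
  proof (cases "x \<in> {-R..R}")
    case True
    then have "\<bar>\<phi> x\<bar> * exp (x\<^sup>2 / 2) \<le> max B 0" using bspec[OF B True] by (simp add: abs_mult)
    then show ?thesis by (simp add: exp_minus field_simps)
  next
    case False
    then have "\<phi> x = 0" using R[of x] by auto
    then show ?thesis by simp
  qed
  then show ?thesis by blast
qed

lemma L2rho_test_integrable:
  assumes "in_L2rho g" "test_fun \<phi>" shows "integrable lborel (\<lambda>x. g x * \<phi> x)"
proof -
  obtain B where "\<And>x. \<bar>\<phi> x\<bar> \<le> B * exp (- (x\<^sup>2) / 2)" using test_fun_le_gauss[OF assms(2)] by blast
  then show ?thesis
    using assms smooth_fun_measurable by (intro L2rho_gauss_bound(1)[of 1 g \<phi> B]) (auto simp: test_fun_iff)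
qed

text \<open>The definition relates every \<open>g i\<close> to \<open>f\<close> only, not to its
  neighbour. Testing order \<open>Suc i\<close> with \<eta> and order \<open>i\<close> with its
  derivative gives the same integral of \<open>f\<close>, and comparing the two leaves one
  integration by parts. For i = 0 the definition of order 1 is this claim already.\<close>

lemma sobolev_H_weak_deriv_step:
  assumes H: "sobolev_H \<alpha> f g" and "Suc i \<le> \<alpha>" and \<eta>: "test_fun \<eta>"
  shows "integral\<^sup>L lborel (\<lambda>x. g i x * deriv \<eta> x) = - integral\<^sup>L lborel (\<lambda>x. g (Suc i) x * \<eta> x)"
proof (cases i)
  case 0
  have "weak_deriv 1 f (g 1)" using H assms(2) 0 by (auto simp: sobolev_H_def)
  then show ?thesis using H \<eta> by (simp add: weak_deriv_def sobolev_H_def 0)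
next
  case (Suc j)
  have 1: "weak_deriv (Suc i) f (g (Suc i))" and 2: "weak_deriv i f (g i)"
    using H assms(2) Suc by (auto simp: sobolev_H_def)
  from 1 \<eta> have "integral\<^sup>L lborel (\<lambda>x. f x * (deriv ^^ Suc i) \<eta> x)
      = (-1) ^ Suc i * integral\<^sup>L lborel (\<lambda>x. g (Suc i) x * \<eta> x)"
    by (simp add: weak_deriv_def del: funpow.simps power_Suc)
  moreover from 2 test_fun_deriv[OF \<eta>] have "integral\<^sup>L lborel (\<lambda>x. f x * (deriv ^^ i) (deriv \<eta>) x)
      = (-1) ^ i * integral\<^sup>L lborel (\<lambda>x. g i x * deriv \<eta> x)"
    by (simp add: weak_deriv_def)
  ultimately have "(-1) ^ i * integral\<^sup>L lborel (\<lambda>x. g i x * deriv \<eta> x)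
      = (-1) ^ i * (- integral\<^sup>L lborel (\<lambda>x. g (Suc i) x * \<eta> x))"
    unfolding iter_deriv_shift by simp
  then show ?thesis by (subst (asm) mult_left_cancel) auto
qed

text \<open>By the product rule, moving one derivative off \<phi> gives two integrals, one with
  \<open>g (Suc i)\<close> and \<psi>, one with \<open>g i\<close> and \<open>deriv \<psi>\<close>.
  After \<open>k\<close> rounds there are \<open>2 ^ k\<close> integrals in which \<phi> is
  undifferentiated, so only the size of \<phi> enters; each is bounded by Cauchy-Schwarz.\<close>

lemma sobolev_H_ibp_bound:
  assumes H: "sobolev_H \<alpha> f g" and \<beta>: "\<beta> > 1/2" and "i + k \<le> \<alpha>"
    and "test_fun \<psi>" "smooth_fun \<phi>"
    and "\<And>j x. j \<le> k \<Longrightarrow> \<bar>(deriv ^^ j) \<psi> x * \<phi> x\<bar> \<le> K * exp (- (\<beta> * x\<^sup>2) / 2)"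
  shows "\<bar>integral\<^sup>L lborel (\<lambda>x. g i x * (\<psi> x * (deriv ^^ k) \<phi> x))\<bar>
      \<le> 2 ^ k * (K * gauss_const \<beta> * sobolev_norm \<alpha> g)"
  using assms(3-)
proof (induction k arbitrary: i \<psi>)
  case 0
  have g: "in_L2rho (g i)" using H 0 by (auto simp: sobolev_H_def)
  have K: "K \<ge> 0" using order_trans[OF abs_ge_zero 0(4)[of 0 0]] by simp
  have "\<bar>integral\<^sup>L lborel (\<lambda>x. g i x * (\<psi> x * \<phi> x))\<bar> \<le> K * gauss_const \<beta> * L2rho_norm (g i)"
  proof (rule L2rho_gauss_bound(2)[OF \<beta> g])
    show "(\<lambda>x. \<psi> x * \<phi> x) \<in> borel_measurable borel"
      using 0 by (intro smooth_fun_measurable smooth_fun_mult) (auto simp: test_fun_iff)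
    show "\<bar>\<psi> x * \<phi> x\<bar> \<le> K * exp (- (\<beta> * x\<^sup>2) / 2)" for x using 0(4)[of 0 x] by simp
  qed
  also have "\<dots> \<le> K * gauss_const \<beta> * sobolev_norm \<alpha> g"
    using K gauss_const_nonneg 0(1) by (intro mult_left_mono L2rho_norm_le_sobolev_norm) auto
  finally show ?case by simp
next
  case (Suc k)
  let ?\<phi> = "(deriv ^^ k) \<phi>"
  have \<psi>: "smooth_fun \<psi>" using Suc.prems by (simp add: test_fun_iff)
  have \<phi>: "smooth_fun ?\<phi>" by (rule smooth_fun_iter_deriv[OF Suc.prems(3)])
  have \<psi>': "test_fun (deriv \<psi>)" by (rule test_fun_deriv[OF Suc.prems(2)])
  have g: "in_L2rho (g i)" using H Suc.prems(1) by (auto simp: sobolev_H_def)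
  have "(\<lambda>x. g i x * (\<psi> x * (deriv ^^ Suc k) \<phi> x))
      = (\<lambda>x. g i x * deriv (\<lambda>x. \<psi> x * ?\<phi> x) x - g i x * (deriv \<psi> x * ?\<phi> x))"
    unfolding deriv_mult_smooth[OF \<psi> \<phi>] by (simp add: algebra_simps)
  then have "integral\<^sup>L lborel (\<lambda>x. g i x * (\<psi> x * (deriv ^^ Suc k) \<phi> x))
      = integral\<^sup>L lborel (\<lambda>x. g i x * deriv (\<lambda>x. \<psi> x * ?\<phi> x) x)
        - integral\<^sup>L lborel (\<lambda>x. g i x * (deriv \<psi> x * ?\<phi> x))"
    using L2rho_test_integrable[OF g test_fun_deriv[OF test_fun_mult[OF Suc.prems(2) \<phi>]]]
      L2rho_test_integrable[OF g test_fun_mult[OF \<psi>' \<phi>]] by simp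
  also have "integral\<^sup>L lborel (\<lambda>x. g i x * deriv (\<lambda>x. \<psi> x * ?\<phi> x) x)
      = - integral\<^sup>L lborel (\<lambda>x. g (Suc i) x * (\<psi> x * ?\<phi> x))"
    using Suc.prems(1) by (intro sobolev_H_weak_deriv_step[OF H] test_fun_mult[OF Suc.prems(2) \<phi>]) auto
  finally have "\<bar>integral\<^sup>L lborel (\<lambda>x. g i x * (\<psi> x * (deriv ^^ Suc k) \<phi> x))\<bar>
      \<le> \<bar>integral\<^sup>L lborel (\<lambda>x. g (Suc i) x * (\<psi> x * ?\<phi> x))\<bar>
        + \<bar>integral\<^sup>L lborel (\<lambda>x. g i x * (deriv \<psi> x * ?\<phi> x))\<bar>" by linarith
  moreover have "\<bar>integral\<^sup>L lborel (\<lambda>x. g (Suc i) x * (\<psi> x * ?\<phi> x))\<bar>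
      \<le> 2 ^ k * (K * gauss_const \<beta> * sobolev_norm \<alpha> g)"
    using Suc.prems by (intro Suc.IH) auto
  moreover have "\<bar>integral\<^sup>L lborel (\<lambda>x. g i x * (deriv \<psi> x * ?\<phi> x))\<bar>
      \<le> 2 ^ k * (K * gauss_const \<beta> * sobolev_norm \<alpha> g)"
  proof (intro Suc.IH \<psi>' Suc.prems(3))
    show "\<bar>(deriv ^^ j) (deriv \<psi>) x * \<phi> x\<bar> \<le> K * exp (- (\<beta> * x\<^sup>2) / 2)" if "j \<le> k" for j x
      unfolding iter_deriv_shift using that by (intro Suc.prems(4)) auto
  qed (use Suc.prems(1) in auto)
  ultimately show ?case by simp
qed

subsection \<open>Periodic kernels\<close>

lemma periodic_add_of_int:
  fixes u :: "real \<Rightarrow> 'a"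
  assumes "\<And>x. u (x + 1) = u x"
  shows "u (x + of_int k) = u x"
proof (induction k rule: int_induct[of _ 0])
  case (step1 i)
  then show ?case using assms[of "x + of_int i"] by (simp add: add_ac)
next
  case (step2 i)
  then show ?case using assms[of "x + of_int (i - 1)"] by (simp add: add_ac)
qed simp

lemma antiderivative_UNIV:
  fixes u :: "real \<Rightarrow> real"
  assumes "continuous_on UNIV u"
  shows "\<exists>U. \<forall>x. (U has_real_derivative u x) (at x)"
proof -
  have "\<exists>F. \<forall>x::real. - \<infinity> < ereal x \<longrightarrow> ereal x < \<infinity> \<longrightarrow> (F has_vector_derivative u x) (at x)"
    using assms by (intro einterval_antiderivative) (auto simp: continuous_on_eq_continuous_at)
  then show ?thesis by (simp add: has_real_derivative_iff_has_vector_derivative)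
qed

lemma integral_eq_DERIV_diff:
  fixes U u :: "real \<Rightarrow> real"
  assumes "\<And>x. (U has_real_derivative u x) (at x)" "a \<le> b"
  shows "(u has_integral (U b - U a)) {a..b}"
  using assms
  by (intro fundamental_theorem_of_calculus)
     (auto simp flip: has_real_derivative_iff_has_vector_derivative intro: DERIV_subset)

text \<open>The primitive normalised to mean zero is again a valid input, and its supremum is
  controlled by the L^1 norm of \<open>u\<close> alone.\<close>

lemma periodic_primitive:
  fixes u :: "real \<Rightarrow> real"
  assumes cont: "continuous_on UNIV u" and per: "\<And>x. u (x + 1) = u x"
    and zero: "integral {0..1} u = 0"
  shows "\<exists>U. (\<forall>x. (U has_real_derivative u x) (at x)) \<and> (\<forall>x. U (x + 1) = U x) \<and>
    integral {0..1} U = 0 \<and> (\<forall>x. \<bar>U x\<bar> \<le> integral {0..1} (\<lambda>x. \<bar>u x\<bar>))"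
proof -
  obtain F where F: "\<And>x. (F has_real_derivative u x) (at x)"
    using antiderivative_UNIV[OF cont] by auto
  \<comment> \<open>Mean zero means no net increase over one period; with the periodicity of
    \<open>u\<close> this makes \<open>F\<close> periodic.\<close>
  have F01: "F 1 = F 0"
    using integral_eq_DERIV_diff[OF F, of 0 1] zero by (simp add: has_integral_iff)
  have "((\<lambda>x. F (x + 1) - F x) has_real_derivative u (x + 1) - u x) (at x)" for x
    by (intro DERIV_diff F DERIV_shift[THEN iffD1])
  then have "((\<lambda>x. F (x + 1) - F x) has_real_derivative 0) (at x)" for x by (simp add: per)
  then have Fper: "F (x + 1) = F x" for x
    using DERIV_isconst_all[of "\<lambda>x. F (x + 1) - F x" x 0] F01 by simp
  have contF: "continuous_on A F" for A
    using F DERIV_isCont continuous_at_imp_continuous_on by blast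
  define U where "U x = F x - integral {0..1} F" for x
  have U: "(U has_real_derivative u x) (at x)" for x
    unfolding U_def using DERIV_diff[OF F DERIV_const] by simp
  have Uper: "U (x + 1) = U x" for x by (simp add: U_def Fper)
  have contU: "continuous_on A U" for A
    unfolding U_def by (intro continuous_intros contF)
  have U0: "integral {0..1} U = 0"
    unfolding U_def by (subst integral_diff) (auto intro!: integrable_continuous_real contF)
  let ?M = "integral {0..1} (\<lambda>x. \<bar>u x\<bar>)"
  have int_u: "u integrable_on {a..b}" "(\<lambda>x. \<bar>u x\<bar>) integrable_on {a..b}" for a b
    using cont by (auto intro!: integrable_continuous_real continuous_intros
        intro: continuous_on_subset)
  have incr: "\<bar>U y - U x\<bar> \<le> ?M" if "x \<in> {0..1}" "y \<in> {0..1}" "x \<le> y" for x y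
  proof -
    have "\<bar>U y - U x\<bar> = \<bar>integral {x..y} u\<bar>"
      using integral_eq_DERIV_diff[OF U that(3)] by (simp add: has_integral_iff)
    also have "\<dots> \<le> integral {x..y} (\<lambda>x. \<bar>u x\<bar>)"
      using integral_norm_bound_integral[OF int_u(1) int_u(2), of x y] by simp
    also have "\<dots> \<le> ?M" using that int_u by (intro integral_subset_le) auto
    finally show ?thesis .
  qed
  have bd: "\<bar>U x\<bar> \<le> ?M" if x: "x \<in> {0..1}" for x
  proof -
    \<comment> \<open>As \<open>U\<close> has mean zero, its value is the average of its increments,
      each bounded by the integral of |u|.\<close>
    have "U x = integral {0..1} (\<lambda>y. U x - U y)"
      using U0 by (subst integral_diff) (auto intro!: integrable_continuous_real contU)
    also have "\<bar>\<dots>\<bar> \<le> integral {0..1} (\<lambda>y::real. ?M)"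
    proof (rule integral_norm_bound_integral[where 'a = real, unfolded real_norm_def])
      show "\<bar>U x - U y\<bar> \<le> ?M" if "y \<in> {0..1}" for y
        using incr[OF that x] incr[OF x that] by (cases "x \<le> y") (auto simp: abs_minus_commute)
    qed (auto intro!: integrable_continuous_real continuous_intros contU)
    finally show ?thesis by simp
  qed
  have "\<bar>U x\<bar> \<le> ?M" for x
    using bd[of "frac x"] periodic_add_of_int[of U "frac x" "\<lfloor>x\<rfloor>", OF Uper]
    by (simp add: frac_def less_imp_le[OF frac_lt_1[unfolded frac_def]] frac_ge_0[unfolded frac_def])
  then show ?thesis using U Uper U0 by (intro exI[of _ U]) simp
qed

text \<open>The first primitive is bounded by the L^1 norm of \<open>u\<close>, hence by
  \<open>M\<close>; over a unit period its own L^1 norm is then at most \<open>M\<close>, so the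
  same bound passes to every further primitive. A kernel may thus be arbitrarily concentrated
  without enlarging \<open>M\<close>, provided at least one primitive is taken.\<close>

lemma periodic_iterated_primitive:
  fixes u :: "real \<Rightarrow> real"
  assumes "k \<ge> 1" "smooth_fun u" "\<And>x. u (x + 1) = u x" "integral {0..1} u = 0"
    "integral {0..1} (\<lambda>x. \<bar>u x\<bar>) \<le> M"
  shows "\<exists>\<Phi>. smooth_fun \<Phi> \<and> (\<forall>x. \<bar>\<Phi> x\<bar> \<le> M) \<and> (deriv ^^ k) \<Phi> = u"
  using assms
proof (induction k arbitrary: u rule: nat_induct_at_least)
  case base
  obtain U where U: "\<And>x. (U has_real_derivative u x) (at x)" "\<And>x. U (x + 1) = U x"
      "integral {0..1} U = 0" "\<And>x. \<bar>U x\<bar> \<le> integral {0..1} (\<lambda>x. \<bar>u x\<bar>)"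
    using periodic_primitive[OF smooth_fun_continuous_on[OF base(1)] base(2,3)] by auto
  have "deriv U = u" by (rule ext) (rule DERIV_imp_deriv[OF U(1)])
  moreover have "smooth_fun U" by (rule smooth_fun_antideriv[OF base(1) U(1)])
  moreover have "\<bar>U x\<bar> \<le> M" for x using U(4)[of x] base(4) by linarith
  ultimately show ?case by (intro exI[of _ U]) simp
next
  case (Suc k)
  obtain U where U: "\<And>x. (U has_real_derivative u x) (at x)" "\<And>x. U (x + 1) = U x"
      "integral {0..1} U = 0" "\<And>x. \<bar>U x\<bar> \<le> integral {0..1} (\<lambda>x. \<bar>u x\<bar>)"
    using periodic_primitive[OF smooth_fun_continuous_on[OF Suc.prems(1)] Suc.prems(2,3)] by auto
  have dU: "deriv U = u" by (rule ext) (rule DERIV_imp_deriv[OF U(1)])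
  have sU: "smooth_fun U" by (rule smooth_fun_antideriv[OF Suc.prems(1) U(1)])
  have "\<bar>U x\<bar> \<le> M" for x using U(4)[of x] Suc.prems(4) by linarith
  then have "integral {0..1} (\<lambda>x. \<bar>U x\<bar>) \<le> integral {0..1} (\<lambda>x::real. M)"
    by (intro integral_le integrable_continuous_real continuous_on_rabs
        smooth_fun_continuous_on[OF sU]) auto
  then obtain \<Phi> where "smooth_fun \<Phi>" "\<forall>x. \<bar>\<Phi> x\<bar> \<le> M" "(deriv ^^ k) \<Phi> = U"
    using Suc.IH[OF sU U(2,3)] by auto
  then show ?case by (intro exI[of _ \<Phi>]) (simp add: dU)
qed

lemma smooth_fun_cos: "smooth_fun cos"
proof (rule smooth_fun_closedI)
  let ?f = "\<lambda>(a, b) x. a * cos x + b * sin (x::real)"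
  have "cos = ?f (1, 0)" by auto
  then show "cos \<in> range ?f" by blast
  fix v assume "v \<in> range ?f"
  then obtain a b where v: "v = ?f (a, b)" by auto
  have "(?f (a, b) has_real_derivative ?f (b, - a) x) (at x)" for x
    by (auto intro!: derivative_eq_intros)
  then show "\<exists>w\<in>range ?f. \<forall>x. (v has_real_derivative w x) (at x)"
    unfolding v by (intro bexI[of _ "?f (b, - a)"] allI rangeI)
qed

lemma periodic_kernel_exists:
  fixes \<delta> :: real
  assumes "0 < \<delta>" "\<delta> < 1/2"
  shows "\<exists>q. smooth_fun q \<and> (\<forall>x. q x \<ge> 0) \<and> (\<forall>x. q (x + 1) = q x) \<and> integral {0..1} q = 1 \<and>
    (\<forall>x\<in>{0..1}. \<bar>x - 1/2\<bar> \<ge> \<delta> \<longrightarrow> q x = 0)"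
proof -
  \<comment> \<open>The argument of \<open>flat_exp\<close> is positive exactly where
    \<open>x\<close> is closer than \<delta> to 1/2 plus an integer. The bump sits in the middle of
    the period and does not straddle its ends.\<close>
  define q0 where "q0 x = flat_exp (cos (2 * pi * x + - pi) + - cos (2 * pi * \<delta>))" for x
  have s: "smooth_fun q0"
    unfolding q0_def
    by (intro smooth_fun_compose[OF smooth_fun_flat_exp] smooth_fun_add
        smooth_fun_compose[OF smooth_fun_cos] smooth_fun_affine smooth_fun_const)
  have nn: "q0 x \<ge> 0" for x by (simp add: q0_def flat_exp_nonneg)
  have per: "q0 (x + 1) = q0 x" for x
    using cos_periodic[of "2 * pi * x + - pi"] by (simp add: q0_def algebra_simps)
  have "cos (2 * pi * \<delta>) < cos 0"
    using assms by (intro cos_monotone_0_pi) auto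
  then have "q0 (1/2) > 0" by (simp add: q0_def flat_exp_def)
  then have "integral {0..1} q0 \<noteq> 0"
    using integral_eq_0_iff[OF smooth_fun_continuous_on[OF s], of 0 1] nn
    by (auto dest!: bspec[of _ _ "1/2"])
  moreover have "integral {0..1} q0 \<ge> 0"
    by (intro integral_nonneg integrable_continuous_real smooth_fun_continuous_on s) (auto simp: nn)
  ultimately have pos: "integral {0..1} q0 > 0" by simp
  have supp: "q0 x = 0" if "x \<in> {0..1}" "\<bar>x - 1/2\<bar> \<ge> \<delta>" for x
  proof -
    have "cos (2 * pi * x + - pi) = cos (2 * pi * \<bar>x - 1/2\<bar>)"
    proof -
      have "2 * pi * \<bar>x - 1/2\<bar> = \<bar>2 * pi * x + - pi\<bar>"
        by (simp add: abs_if field_simps)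
      then show ?thesis by simp
    qed
    also have "\<dots> \<le> cos (2 * pi * \<delta>)"
      using that assms by (intro cos_monotone_0_pi_le) (auto simp: abs_if)
    finally show ?thesis by (simp add: q0_def flat_exp_def)
  qed
  define q where "q x = inverse (integral {0..1} q0) * q0 x" for x
  show ?thesis
  proof (intro exI conjI)
    show "smooth_fun q" unfolding q_def by (intro smooth_fun_mult s) simp
    show "\<forall>x. q x \<ge> 0" using pos nn by (simp add: q_def)
    show "\<forall>x. q (x + 1) = q x" by (simp add: q_def per)
    show "integral {0..1} q = 1" using pos unfolding q_def by simp
    show "\<forall>x\<in>{0..1}. \<bar>x - 1/2\<bar> \<ge> \<delta> \<longrightarrow> q x = 0" by (simp add: q_def supp)
  qed
qed

text \<open>The rescaled kernel has mass \<open>h\<close> on each cell, concentrated within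
  \<open>h * \<delta>\<close> of the midpoint, so replacing \<open>F\<close> there by its midpoint
  value costs at most \<open>h * e\<close> per cell. The induction adds one cell at a time.\<close>

lemma periodic_kernel_sum:
  fixes q F :: "real \<Rightarrow> real"
  assumes q: "continuous_on UNIV q" "\<And>x. q x \<ge> 0" "\<And>x. q (x + 1) = q x" "integral {0..1} q = 1"
    and supp: "\<And>x. x \<in> {0..1} \<Longrightarrow> \<bar>x - 1/2\<bar> \<ge> \<delta> \<Longrightarrow> q x = 0"
    and F: "continuous_on UNIV F" and "h > 0" "e \<ge> 0"
    and osc: "\<And>x y. x \<in> {a..a + real N * h} \<Longrightarrow> y \<in> {a..a + real N * h} \<Longrightarrow>
      \<bar>x - y\<bar> < h * \<delta> \<Longrightarrow> \<bar>F x - F y\<bar> \<le> e"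
  shows "\<bar>integral {a..a + real N * h} (\<lambda>x. F x * q ((x - a) / h))
      - h * (\<Sum>i<N. F (a + (real i + 1/2) * h))\<bar> \<le> real N * h * e"
  using osc
proof (induction N)
  case (Suc N)
  let ?q = "\<lambda>x. q ((x - a) / h)"
  let ?b = "a + real N * h" and ?c = "a + real (Suc N) * h" and ?m = "a + (real N + 1/2) * h"
  have contq: "continuous_on A ?q" for A
    using \<open>h > 0\<close> by (intro continuous_on_compose2[OF q(1)] continuous_intros) auto
  have contF: "continuous_on A F" for A using F continuous_on_subset by blast
  have le: "a \<le> ?b" "?b \<le> ?c" using \<open>h > 0\<close> by (auto simp: algebra_simps)
  \<comment> \<open>A periodic primitive \<open>U\<close> of \<open>1 - q\<close> gives the
    antiderivative \<open>x - h * U ((x - a) / h)\<close> of the rescaled kernel; periodicity then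
    yields the mass \<open>h\<close> of any cell without a change of variables.\<close>
  have "continuous_on UNIV (\<lambda>x. 1 - q x)" by (intro continuous_intros q(1))
  moreover have "integral {0..1} (\<lambda>x. 1 - q x) = 0"
    using q(4) by (subst integral_diff)
      (auto intro!: integrable_continuous_real intro: continuous_on_subset[OF q(1)])
  ultimately obtain U where U: "\<And>x. (U has_real_derivative 1 - q x) (at x)" "\<And>x. U (x + 1) = U x"
    using periodic_primitive[of "\<lambda>x. 1 - q x"] q(3) by auto
  have "((\<lambda>x. x - h * U ((x - a) / h)) has_real_derivative ?q x) (at x)" for x
    by (rule derivative_eq_intros DERIV_chain2[OF U(1)] refl | use \<open>h > 0\<close> in \<open>simp; fail\<close>)+
  note ends = integral_eq_DERIV_diff[OF this le(2)]
  have q1: "(?q has_integral h) {?b..?c}"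
  proof -
    have "(?b - a) / h = real N" "(?c - a) / h = real N + 1" using \<open>h > 0\<close> by (auto simp: field_simps)
    with ends show ?thesis by (simp only: U(2)) (simp add: algebra_simps)
  qed
  have "\<bar>integral {?b..?c} (\<lambda>x. (F x - F ?m) * ?q x)\<bar> \<le> integral {?b..?c} (\<lambda>x. e * ?q x)"
  proof (rule integral_norm_bound_integral[where 'a = real, unfolded real_norm_def])
    fix x assume x: "x \<in> {?b..?c}"
    show "\<bar>(F x - F ?m) * ?q x\<bar> \<le> e * ?q x"
    proof (cases "\<bar>x - ?m\<bar> < h * \<delta>")
      case True
      have "\<bar>F x - F ?m\<bar> \<le> e"
      proof (intro Suc.prems True)
        show "x \<in> {a..?c}" using x le by auto
        show "?m \<in> {a..?c}" using \<open>h > 0\<close> by (auto simp: distrib_right)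
      qed
      then show ?thesis by (simp add: abs_mult q(2) mult_right_mono)
    next
      case False
      \<comment> \<open>Shifting by the integer \<open>N\<close> moves the cell to the base period,
        where \<open>supp\<close> applies.\<close>
      let ?y = "(x - a) / h - real N"
      have "?y \<in> {0..1}" using x \<open>h > 0\<close> by (simp add: field_simps)
      moreover have "\<bar>?y - 1/2\<bar> \<ge> \<delta>"
      proof -
        have "?y - 1/2 = (x - ?m) / h" using \<open>h > 0\<close> by (simp add: field_simps)
        then have "\<bar>?y - 1/2\<bar> = \<bar>x - ?m\<bar> / h" using \<open>h > 0\<close> by simp
        then show ?thesis using False \<open>h > 0\<close> by (simp add: field_simps)
      qed
      ultimately have "q ?y = 0" by (rule supp)
      then have "?q x = 0"
        using periodic_add_of_int[of q ?y "int N", OF q(3)] by simp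
      then show ?thesis by simp
    qed
  qed (auto intro!: integrable_continuous_real continuous_intros contF contq)
  also have "\<dots> = e * h" using has_integral_mult_right[OF q1, of e] by (simp add: has_integral_iff)
  also have "integral {?b..?c} (\<lambda>x. (F x - F ?m) * ?q x)
      = integral {?b..?c} (\<lambda>x. F x * ?q x) - integral {?b..?c} (\<lambda>x. F ?m * ?q x)"
    unfolding left_diff_distrib
    by (rule integral_diff) (auto intro!: integrable_continuous_real continuous_intros contF contq)
  also have "integral {?b..?c} (\<lambda>x. F ?m * ?q x) = F ?m * h"
    using has_integral_mult_right[OF q1, of "F ?m"] by (simp add: has_integral_iff)
  finally have last: "\<bar>integral {?b..?c} (\<lambda>x. F x * ?q x) - F ?m * h\<bar> \<le> e * h" .
  have IH: "\<bar>integral {a..?b} (\<lambda>x. F x * ?q x) - h * (\<Sum>i<N. F (a + (real i + 1/2) * h))\<bar> \<le> real N * h * e"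
    using le by (intro Suc.IH Suc.prems) auto
  have split: "integral {a..?c} (\<lambda>x. F x * ?q x)
      = integral {a..?b} (\<lambda>x. F x * ?q x) + integral {?b..?c} (\<lambda>x. F x * ?q x)"
    by (rule Henstock_Kurzweil_Integration.integral_combine[symmetric, OF le])
      (intro integrable_continuous_real continuous_on_mult contF contq)
  have sum: "h * (\<Sum>i<Suc N. F (a + (real i + 1/2) * h))
      = h * (\<Sum>i<N. F (a + (real i + 1/2) * h)) + F ?m * h"
    by (simp add: algebra_simps)
  have "real (Suc N) * h * e = real N * h * e + e * h" by (simp add: algebra_simps)
  then show ?case unfolding split sum using IH last by linarith
qed simp

text \<open>Links the Lebesgue integrals of the weak derivatives with the gauge integrals in which
  the fundamental theorem of calculus is applied.\<close>

lemma lborel_integral_eq_integral_Icc: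
  fixes w :: "real \<Rightarrow> real"
  assumes "continuous_on UNIV w" "\<And>x. x \<notin> {a..b} \<Longrightarrow> w x = 0"
  shows "integral\<^sup>L lborel w = integral {a..b} w"
proof -
  have "set_integrable lborel {a..b} w"
    by (rule borel_integrable_atLeastAtMost') (rule continuous_on_subset[OF assms(1)], simp)
  from set_borel_integral_eq_integral(2)[OF this]
  have "integral\<^sup>L lborel (\<lambda>x. indicator {a..b} x *\<^sub>R w x) = integral {a..b} w"
    by (simp add: set_lebesgue_integral_def)
  moreover have "(\<lambda>x. indicator {a..b} x *\<^sub>R w x) = w"
  proof
    fix x show "indicator {a..b} x *\<^sub>R w x = w x" using assms(2)[of x] by (cases "x \<in> {a..b}") auto
  qed
  ultimately show ?thesis by simp
qed

text \<open>For a concentrated kernel \<open>q\<close>, the function 1 - q is an \<alpha>-th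
  derivative of a function bounded by 2, whatever the width of \<open>q\<close>. Integration by
  parts bounds the integral of \<open>F\<close> against it, while the integral against
  \<open>q\<close> itself approaches the midpoint sum. As the bound ignores the width, the
  approximation error can be made arbitrarily small.\<close>

lemma sobolev_H_trapezoid_bound:
  assumes H: "sobolev_H \<alpha> f g" and \<alpha>: "\<alpha> \<ge> 1" and f: "continuous_on UNIV f"
    and \<psi>: "test_fun \<psi>" and \<beta>: "\<beta> > 1/2" and h: "h > 0"
    and bd: "\<And>j x. j \<le> \<alpha> \<Longrightarrow> \<bar>(deriv ^^ j) \<psi> x\<bar> \<le> K * exp (- (\<beta> * x\<^sup>2) / 2)"
    and supp: "\<And>x. x \<notin> {a..a + real N * h} \<Longrightarrow> \<psi> x = 0"
  shows "\<bar>integral\<^sup>L lborel (\<lambda>x. f x * \<psi> x)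
      - h * (\<Sum>i<N. f (a + (real i + 1/2) * h) * \<psi> (a + (real i + 1/2) * h))\<bar>
    \<le> 2 ^ \<alpha> * (2 * h ^ \<alpha> * K * gauss_const \<beta> * sobolev_norm \<alpha> g)" (is "?E \<le> ?B")
proof (rule field_le_epsilon)
  fix e' :: real assume "e' > 0"
  define e where "e = e' / (real N * h + 1)"
  let ?b = "a + real N * h"
  have Nh: "real N * h \<ge> 0" using h by simp
  have e: "e > 0" "real N * h * e \<le> e'"
    using \<open>e' > 0\<close> Nh by (auto simp: e_def field_simps)
  have s\<psi>: "smooth_fun \<psi>" using \<psi> by (simp add: test_fun_iff)
  define F where "F x = f x * \<psi> x" for x
  have F: "continuous_on A F" for A
    unfolding F_def by (intro continuous_intros smooth_fun_continuous_on s\<psi> continuous_on_subset[OF f]) simp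
  have "uniformly_continuous_on {a..?b} F" by (intro compact_uniformly_continuous F) simp
  then obtain d where d: "d > 0"
      "\<And>x y. x \<in> {a..?b} \<Longrightarrow> y \<in> {a..?b} \<Longrightarrow> \<bar>x - y\<bar> < d \<Longrightarrow> \<bar>F x - F y\<bar> < e"
    using e(1) unfolding uniformly_continuous_on_def dist_real_def by (auto dest!: spec[of _ e])
  \<comment> \<open>The modulus of continuity \<open>d\<close> in units of a cell, capped so that
    \<open>periodic_kernel_exists\<close> applies.\<close>
  define \<delta> where "\<delta> = min (d / h) (1/4)"
  have \<delta>: "0 < \<delta>" "\<delta> < 1/2" "h * \<delta> \<le> d"
    using d(1) h by (auto simp: \<delta>_def min_def field_simps)
  obtain q where q: "smooth_fun q" "\<And>x. q x \<ge> 0" "\<And>x. q (x + 1) = q x" "integral {0..1} q = 1"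
      "\<And>x. x \<in> {0..1} \<Longrightarrow> \<bar>x - 1/2\<bar> \<ge> \<delta> \<Longrightarrow> q x = 0"
    using periodic_kernel_exists[OF \<delta>(1,2)] by blast
  have contq: "continuous_on A q" for A by (rule smooth_fun_continuous_on[OF q(1)])
  have near: "\<bar>integral {a..?b} (\<lambda>x. F x * q ((x - a) / h))
      - h * (\<Sum>i<N. F (a + (real i + 1/2) * h))\<bar> \<le> real N * h * e"
  proof (rule periodic_kernel_sum[OF contq q(2-5) F h])
    show "\<bar>F x - F y\<bar> \<le> e" if "x \<in> {a..?b}" "y \<in> {a..?b}" "\<bar>x - y\<bar> < h * \<delta>" for x y
      using d(2)[OF that(1,2)] that(3) \<delta>(3) by linarith
  qed (use e in auto)
  let ?u = "\<lambda>x. 1 + -1 * q x"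
  have su: "smooth_fun ?u" by (intro smooth_fun_add smooth_fun_mult q) auto
  have iq: "q integrable_on {0..1}" by (intro integrable_continuous_real contq)
  have u0: "integral {0..1} ?u = 0"
    using q(4) integral_diff[OF integrable_const_ivl[of 1 0 1] iq] by simp
  have "integral {0..1} (\<lambda>x. \<bar>?u x\<bar>) \<le> integral {0..1} (\<lambda>x. 1 + q x)"
  proof (rule integral_le)
    show "\<bar>?u x\<bar> \<le> 1 + q x" for x using q(2)[of x] by (simp add: abs_le_iff)
  qed (auto intro!: integrable_continuous_real continuous_intros contq)
  also have "\<dots> = 2" using q(4) iq by (subst integral_add) auto
  finally have "\<exists>\<Phi>. smooth_fun \<Phi> \<and> (\<forall>x. \<bar>\<Phi> x\<bar> \<le> 2) \<and> (deriv ^^ \<alpha>) \<Phi> = ?u"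
    by (intro periodic_iterated_primitive[OF \<alpha> su _ u0]) (simp_all add: q(3))
  then obtain \<Phi> where \<Phi>: "smooth_fun \<Phi>" "\<And>x. \<bar>\<Phi> x\<bar> \<le> 2" "(deriv ^^ \<alpha>) \<Phi> = ?u" by blast
  \<comment> \<open>The factor \<open>h ^ \<alpha>\<close> cancels the powers of 1/h from the chain
    rule; it is the source of the convergence rate.\<close>
  define \<phi> where "\<phi> x = h ^ \<alpha> * \<Phi> (1 / h * x + - a / h)" for x
  have s\<phi>: "smooth_fun \<phi>"
    unfolding \<phi>_def by (intro smooth_fun_mult smooth_fun_compose[OF \<Phi>(1)] smooth_fun_affine smooth_fun_const)
  have arg: "1 / h * x + - a / h = (x - a) / h" for x by (simp add: diff_divide_distrib)
  have d\<phi>: "(deriv ^^ \<alpha>) \<phi> = (\<lambda>x. ?u ((x - a) / h))"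
  proof -
    have "(deriv ^^ \<alpha>) \<phi> = (\<lambda>x. h ^ \<alpha> * (1 / h) ^ \<alpha> * ?u (1 / h * x + - a / h))"
      unfolding \<phi>_def iter_deriv_affine[OF \<Phi>(1)] \<Phi>(3) ..
    then show ?thesis unfolding arg using h by (simp add: power_one_over)
  qed
  have "\<bar>integral\<^sup>L lborel (\<lambda>x. g 0 x * (\<psi> x * (deriv ^^ \<alpha>) \<phi> x))\<bar>
      \<le> 2 ^ \<alpha> * (2 * h ^ \<alpha> * K * gauss_const \<beta> * sobolev_norm \<alpha> g)"
  proof (rule sobolev_H_ibp_bound[OF H \<beta> _ \<psi> s\<phi>])
    fix j x assume "j \<le> \<alpha>"
    have "\<bar>\<phi> x\<bar> \<le> h ^ \<alpha> * 2"
      using \<Phi>(2)[of "1 / h * x + - a / h"] h by (simp add: \<phi>_def abs_mult)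
    then have "\<bar>(deriv ^^ j) \<psi> x\<bar> * \<bar>\<phi> x\<bar> \<le> (K * exp (- (\<beta> * x\<^sup>2) / 2)) * (h ^ \<alpha> * 2)"
      using order_trans[OF abs_ge_zero bd[OF \<open>j \<le> \<alpha>\<close>, of x]]
      by (intro mult_mono bd[OF \<open>j \<le> \<alpha>\<close>]) auto
    then show "\<bar>(deriv ^^ j) \<psi> x * \<phi> x\<bar> \<le> 2 * h ^ \<alpha> * K * exp (- (\<beta> * x\<^sup>2) / 2)"
      by (simp add: abs_mult mult_ac)
  qed simp
  moreover have "(\<lambda>x. g 0 x * (\<psi> x * (deriv ^^ \<alpha>) \<phi> x)) = (\<lambda>x. F x - F x * q ((x - a) / h))"
    using H by (auto simp: d\<phi> F_def sobolev_H_def algebra_simps)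
  moreover have "integral\<^sup>L lborel (\<lambda>x. F x - F x * q ((x - a) / h))
      = integral {a..?b} F - integral {a..?b} (\<lambda>x. F x * q ((x - a) / h))"
  proof -
    have cont: "continuous_on A (\<lambda>x. F x * q ((x - a) / h))" for A
      using h by (intro continuous_intros F continuous_on_compose2[OF contq[of UNIV]]) auto
    have "integral\<^sup>L lborel (\<lambda>x. F x - F x * q ((x - a) / h))
        = integral {a..?b} (\<lambda>x. F x - F x * q ((x - a) / h))"
    proof (rule lborel_integral_eq_integral_Icc)
      show "continuous_on UNIV (\<lambda>x. F x - F x * q ((x - a) / h))"
        by (intro continuous_on_diff F cont)
      show "F x - F x * q ((x - a) / h) = 0" if "x \<notin> {a..?b}" for x
        using supp[OF that] by (simp add: F_def)
    qed
    also have "\<dots> = integral {a..?b} F - integral {a..?b} (\<lambda>x. F x * q ((x - a) / h))"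
      by (intro integral_diff integrable_continuous_real F cont)
    finally show ?thesis .
  qed
  moreover have "integral\<^sup>L lborel (\<lambda>x. f x * \<psi> x) = integral {a..?b} F"
    using lborel_integral_eq_integral_Icc[OF F[of UNIV], of a ?b] supp unfolding F_def by simp
  ultimately have "\<bar>integral\<^sup>L lborel (\<lambda>x. f x * \<psi> x) - integral {a..?b} (\<lambda>x. F x * q ((x - a) / h))\<bar> \<le> ?B"
    by simp
  then show "?E \<le> ?B + e'" using near e(2) unfolding F_def by linarith
qed

subsection \<open>Pointwise bounds and the Gaussian cutoff\<close>

text \<open>One integration by parts against a steep step at \<open>a\<close>: its derivative
  approximates \<open>s\<close> times a point mass at \<open>a\<close>. The step vanishes on the
  side where s (x - a) \<le> 0, so bounds on \<psi> are needed only along the ray from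
  \<open>a\<close> in direction \<open>s\<close>.\<close>

lemma sobolev_H_pointwise_bound:
  assumes H: "sobolev_H \<alpha> f g" and \<alpha>: "\<alpha> \<ge> 1" and f: "continuous_on UNIV f"
    and \<psi>: "test_fun \<psi>" and \<beta>: "\<beta> > 1/2" and s: "s = 1 \<or> s = (- 1 :: real)" and K: "K \<ge> 0"
    and bd: "\<And>j x. j \<le> 1 \<Longrightarrow> s * (x - a) \<ge> 0 \<Longrightarrow> \<bar>(deriv ^^ j) \<psi> x\<bar> \<le> K * exp (- (\<beta> * x\<^sup>2) / 2)"
  shows "\<bar>f a * \<psi> a\<bar> \<le> 2 * (K * gauss_const \<beta> * sobolev_norm \<alpha> g)" (is "_ \<le> ?B")
proof (rule field_le_epsilon)
  fix e' :: real assume "e' > 0"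
  obtain M where M: "M \<ge> 0" "\<And>x. \<bar>deriv smooth_step x\<bar> \<le> M"
  proof -
    obtain M where "M \<ge> 0" "\<And>j x. j \<le> 1 \<Longrightarrow> \<bar>(deriv ^^ j) smooth_step x\<bar> \<le> M"
      using iter_derivs_smooth_step_bounded[of 1] by blast
    from this(1) this(2)[of 1] show thesis by (intro that[of M]) auto
  qed
  \<comment> \<open>The error integrates \<open>e * (k * M)\<close> over length 2/k, giving
    \<open>2 * e * M\<close>; the added 1 covers M = 0.\<close>
  define e where "e = e' / (2 * M + 1)"
  have e: "e > 0" "2 * e * M \<le> e'" using \<open>e' > 0\<close> M(1) by (auto simp: e_def field_simps)
  have s\<psi>: "smooth_fun \<psi>" using \<psi> by (simp add: test_fun_iff)
  define F where "F x = f x * \<psi> x" for x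
  have F: "continuous_on A F" for A
    unfolding F_def by (intro continuous_on_mult smooth_fun_continuous_on s\<psi> continuous_on_subset[OF f]) simp
  obtain d where d: "d > 0" "\<And>x. \<bar>x - a\<bar> < d \<Longrightarrow> \<bar>F x - F a\<bar> < e"
  proof -
    have "\<exists>d>0. \<forall>x'. dist x' a < d \<longrightarrow> dist (F x') (F a) < e"
      using F[of UNIV] e(1) unfolding continuous_on_iff by simp
    then show thesis using that by (auto simp: dist_real_def)
  qed
  \<comment> \<open>The step rises over length 1/k = d/2, inside the neighbourhood where
    \<open>F\<close> is close to \<open>F a\<close>.\<close>
  define k where "k = 2 / d"
  have k: "k > 0" "1 / k < d" using d(1) by (auto simp: k_def)
  define \<phi> where "\<phi> x = 1 * smooth_step ((s * k) * x + - (s * k * a))" for x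
  have s\<phi>: "smooth_fun \<phi>"
    unfolding \<phi>_def
    by (intro smooth_fun_mult smooth_fun_compose[OF smooth_fun_smooth_step] smooth_fun_affine smooth_fun_const)
  have arg: "(s * k) * x + - (s * k * a) = k * (s * (x - a))" for x by (simp add: algebra_simps)
  have \<phi>0: "\<phi> x = 0" if "s * (x - a) \<le> 0" for x
    unfolding \<phi>_def arg using that k(1) by (simp add: smooth_step_eq_0 mult_nonneg_nonpos)
  have \<phi>1: "\<bar>\<phi> x\<bar> \<le> 1" for x
    using smooth_step_bounds[of "(s * k) * x + - (s * k * a)"] by (simp add: \<phi>_def)
  have d\<phi>: "deriv \<phi> x = s * k * deriv smooth_step (k * (s * (x - a)))" for x
    using iter_deriv_affine[OF smooth_fun_smooth_step, of 1 1 "s * k" "- (s * k * a)"]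
    unfolding \<phi>_def arg by simp
  \<comment> \<open>An interval on both sides of \<open>a\<close> serves both values of
    \<open>s\<close>; the step rises from 0 to 1 on it or falls from 1 to 0.\<close>
  let ?l = "a - 1 / k" and ?r = "a + 1 / k"
  have abs_s: "\<bar>s\<bar> = 1" using s by auto
  have supp: "deriv \<phi> x = 0" if "x \<notin> {?l..?r}" for x
  proof -
    have "1 / k < \<bar>x - a\<bar>" using that by auto
    then have "k * \<bar>x - a\<bar> > 1" using k(1) by (simp add: field_simps)
    then have "\<bar>k * (s * (x - a))\<bar> > 1" using k(1) abs_s by (simp add: abs_mult)
    then have "k * (s * (x - a)) < 0 \<or> k * (s * (x - a)) > 1" by linarith
    then show ?thesis
      unfolding d\<phi> using iter_deriv_smooth_step_eq_0[of 1] by simp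
  qed
  have d\<phi>_bd: "\<bar>deriv \<phi> x\<bar> \<le> k * M" for x
    unfolding d\<phi> using M(2)[of "k * (s * (x - a))"] k(1) abs_s by (simp add: abs_mult)
  have cont: "continuous_on A (deriv \<phi>)" for A
    by (intro smooth_fun_continuous_on smooth_fun_deriv s\<phi>)
  have "\<bar>integral\<^sup>L lborel (\<lambda>x. g 0 x * (\<psi> x * (deriv ^^ 1) \<phi> x))\<bar>
      \<le> 2 ^ 1 * (K * gauss_const \<beta> * sobolev_norm \<alpha> g)"
  proof (rule sobolev_H_ibp_bound[OF H \<beta> _ \<psi> s\<phi>])
    fix j :: nat and x :: real assume "j \<le> 1"
    show "\<bar>(deriv ^^ j) \<psi> x * \<phi> x\<bar> \<le> K * exp (- (\<beta> * x\<^sup>2) / 2)"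
    proof (cases "s * (x - a) \<ge> 0")
      case True
      have "\<bar>(deriv ^^ j) \<psi> x\<bar> * \<bar>\<phi> x\<bar> \<le> (K * exp (- (\<beta> * x\<^sup>2) / 2)) * 1"
        using K by (intro mult_mono bd \<open>j \<le> 1\<close> True \<phi>1) auto
      then show ?thesis by (simp add: abs_mult)
    next
      case False
      then show ?thesis using \<phi>0[of x] K by simp
    qed
  qed (use \<alpha> in simp)
  moreover have "(\<lambda>x. g 0 x * (\<psi> x * (deriv ^^ 1) \<phi> x)) = (\<lambda>x. F x * deriv \<phi> x)"
    using H by (auto simp: F_def sobolev_H_def)
  moreover have "integral\<^sup>L lborel (\<lambda>x. F x * deriv \<phi> x) = integral {?l..?r} (\<lambda>x. F x * deriv \<phi> x)"
    by (intro lborel_integral_eq_integral_Icc continuous_on_mult F cont) (simp add: supp)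
  ultimately have main: "\<bar>integral {?l..?r} (\<lambda>x. F x * deriv \<phi> x)\<bar> \<le> ?B" by simp
  have "?l \<le> ?r" using k(1) by simp
  note ftc = integral_eq_DERIV_diff[OF smooth_fun_DERIV[OF s\<phi>] this]
  have "\<phi> ?r - \<phi> ?l = s"
    using s k(1) unfolding \<phi>_def arg by (auto simp: smooth_step_eq_0 smooth_step_eq_1)
  then have "integral {?l..?r} (\<lambda>x. F a * deriv \<phi> x) = F a * s"
    using has_integral_mult_right[OF ftc, of "F a"] by (simp add: has_integral_iff)
  moreover have "integral {?l..?r} (\<lambda>x. (F x - F a) * deriv \<phi> x)
      = integral {?l..?r} (\<lambda>x. F x * deriv \<phi> x) - integral {?l..?r} (\<lambda>x. F a * deriv \<phi> x)"
    unfolding left_diff_distrib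
    by (intro integral_diff integrable_continuous_real continuous_on_mult F cont continuous_on_const)
  moreover have "\<bar>integral {?l..?r} (\<lambda>x. (F x - F a) * deriv \<phi> x)\<bar> \<le> integral {?l..?r} (\<lambda>x. e * (k * M))"
  proof (rule integral_norm_bound_integral[where 'a = real, unfolded real_norm_def])
    fix x assume "x \<in> {?l..?r}"
    then have "\<bar>x - a\<bar> < d" using k(2) by (auto simp: abs_if)
    then have "\<bar>F x - F a\<bar> * \<bar>deriv \<phi> x\<bar> \<le> e * (k * M)"
      using d(2)[of x] e(1) by (intro mult_mono d\<phi>_bd) auto
    then show "\<bar>(F x - F a) * deriv \<phi> x\<bar> \<le> e * (k * M)" by (simp add: abs_mult)
  qed (intro integrable_continuous_real continuous_on_mult continuous_on_diff F cont continuous_on_const)+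
  moreover have "integral {?l..?r} (\<lambda>x. e * (k * M)) = 2 * e * M"
    using k(1) by simp
  ultimately have "\<bar>F a * s\<bar> \<le> ?B + e'" using main e(2) by linarith
  then show "\<bar>f a * \<psi> a\<bar> \<le> ?B + e'" using abs_s by (simp add: abs_mult F_def)
qed

section \<open>Derivatives of the Gaussian density and its smooth truncation\<close>

lemma DERIV_gauss_rho_mult_poly:
  "((\<lambda>x. poly p x * gauss_rho x) has_real_derivative
     poly (pderiv p - [:0, 1:] * p) x * gauss_rho x) (at x)"
  unfolding gauss_rho_def
  by (rule derivative_eq_intros poly_DERIV refl | simp)+ (simp add: field_simps)

text \<open>The polynomials are the Hermite polynomials up to sign. Their existence suffices, since
  an arbitrarily small part of the Gaussian exponent absorbs any polynomial.\<close>

lemma iter_deriv_gauss_rho: "\<exists>p. (deriv ^^ k) gauss_rho = (\<lambda>x. poly p x * gauss_rho x)"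
proof (induction k)
  case 0
  show ?case by (rule exI[of _ 1]) simp
next
  case (Suc k)
  then obtain p where p: "(deriv ^^ k) gauss_rho = (\<lambda>x. poly p x * gauss_rho x)" by blast
  have "deriv (\<lambda>x. poly p x * gauss_rho x) = (\<lambda>x. poly (pderiv p - [:0, 1:] * p) x * gauss_rho x)"
    by (rule ext) (rule DERIV_imp_deriv[OF DERIV_gauss_rho_mult_poly])
  then show ?case by (intro exI[of _ "pderiv p - [:0, 1:] * p"]) (simp add: p)
qed

lemma smooth_fun_gauss_rho: "smooth_fun gauss_rho"
  unfolding smooth_fun_def
proof (intro allI)
  fix k x
  obtain p where "(deriv ^^ k) gauss_rho = (\<lambda>x. poly p x * gauss_rho x)"
    using iter_deriv_gauss_rho by blast
  then show "(deriv ^^ k) gauss_rho differentiable at x"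
    using DERIV_gauss_rho_mult_poly real_differentiable_def by metis
qed

text \<open>Horner's scheme: half of the exponent absorbs the new factor \<open>x\<close>, the other
  half the remaining polynomial.\<close>

lemma poly_le_exp_square:
  fixes p :: "real poly"
  assumes "c > 0"
  shows "\<exists>K\<ge>0. \<forall>x. \<bar>poly p x\<bar> \<le> K * exp (c * x\<^sup>2)"
  using assms
proof (induction p arbitrary: c)
  case 0
  show ?case by (intro exI[of _ 0]) simp
next
  case (pCons a p)
  obtain K where K: "K \<ge> 0" "\<And>x. \<bar>poly p x\<bar> \<le> K * exp (c / 2 * x\<^sup>2)"
    using pCons.IH[of "c / 2"] pCons.prems by auto
  \<comment> \<open>Chosen so that 1 + x^2 is at most m (1 + c x^2 / 2), which the exponential
    dominates.\<close>
  define m where "m = max 1 (2 / c)"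
  have m: "m \<ge> 1" "m * (c / 2) \<ge> 1" using pCons.prems by (auto simp: m_def max_def field_simps)
  have x: "\<bar>x\<bar> \<le> m * exp (c / 2 * x\<^sup>2)" for x :: real
  proof -
    have "0 \<le> (\<bar>x\<bar> - 1)\<^sup>2" by simp
    then have "2 * \<bar>x\<bar> \<le> 1 + x\<^sup>2" by (simp add: power2_diff)
    then have "\<bar>x\<bar> \<le> 1 + x\<^sup>2" by linarith
    also have "\<dots> \<le> m * 1 + (m * (c / 2)) * x\<^sup>2"
      using m mult_right_mono[OF m(2), of "x\<^sup>2"] by simp
    also have "\<dots> = m * (1 + c / 2 * x\<^sup>2)" by (simp add: algebra_simps)
    also have "\<dots> \<le> m * exp (c / 2 * x\<^sup>2)" using m by (intro mult_left_mono exp_ge_add_one_self) auto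
    finally show ?thesis .
  qed
  have "\<bar>poly (pCons a p) x\<bar> \<le> (\<bar>a\<bar> + m * K) * exp (c * x\<^sup>2)" for x
  proof -
    have "\<bar>x\<bar> * \<bar>poly p x\<bar> \<le> (m * exp (c / 2 * x\<^sup>2)) * (K * exp (c / 2 * x\<^sup>2))"
      using m by (intro mult_mono x K) auto
    also have "\<dots> = m * K * exp (c * x\<^sup>2)" by (simp add: mult_ac flip: exp_add)
    finally have "\<bar>x * poly p x\<bar> \<le> m * K * exp (c * x\<^sup>2)" by (simp add: abs_mult)
    moreover have "\<bar>a\<bar> \<le> \<bar>a\<bar> * exp (c * x\<^sup>2)"
      using pCons.prems by (intro mult_right_mono[of 1, simplified] mult_le_cancel_left1[THEN iffD2]) auto
    ultimately show ?thesis by (simp add: distrib_right)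
  qed
  then show ?case using m K(1) by (intro exI[of _ "\<bar>a\<bar> + m * K"]) auto
qed

lemma iter_derivs_gauss_rho_bounded:
  assumes "\<theta> < 1"
  shows "\<exists>K\<ge>0. \<forall>j\<le>k. \<forall>x. \<bar>(deriv ^^ j) gauss_rho x\<bar> \<le> K * exp (- (\<theta> * x\<^sup>2) / 2)"
proof -
  have "\<exists>K\<ge>0. \<forall>x. \<bar>(deriv ^^ j) gauss_rho x\<bar> \<le> K * exp (- (\<theta> * x\<^sup>2) / 2)" for j
  proof -
    obtain p where p: "(deriv ^^ j) gauss_rho = (\<lambda>x. poly p x * gauss_rho x)"
      using iter_deriv_gauss_rho by blast
    obtain K where K: "K \<ge> 0" "\<And>x. \<bar>poly p x\<bar> \<le> K * exp ((1 - \<theta>) / 2 * x\<^sup>2)"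
      using poly_le_exp_square[of "(1 - \<theta>) / 2" p] assms by auto
    have "\<bar>(deriv ^^ j) gauss_rho x\<bar> \<le> K * exp (- (\<theta> * x\<^sup>2) / 2)" for x
    proof -
      have "\<bar>poly p x\<bar> * gauss_rho x \<le> (K * exp ((1 - \<theta>) / 2 * x\<^sup>2)) * exp (- (x\<^sup>2) / 2)"
        using K(1) by (intro mult_mono K gauss_rho_le_exp less_imp_le[OF gauss_rho_pos]) auto
      also have "\<dots> = K * exp (- (\<theta> * x\<^sup>2) / 2)"
        by (simp add: mult.assoc flip: exp_add) (simp add: field_simps)
      finally show ?thesis using gauss_rho_pos[of x] by (simp add: p abs_mult)
    qed
    then show ?thesis using K(1) by blast
  qed
  then obtain b where b: "\<And>j. b j \<ge> 0" "\<And>j x. \<bar>(deriv ^^ j) gauss_rho x\<bar> \<le> b j * exp (- (\<theta> * x\<^sup>2) / 2)"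
    by metis
  have "\<bar>(deriv ^^ j) gauss_rho x\<bar> \<le> (\<Sum>j\<le>k. b j) * exp (- (\<theta> * x\<^sup>2) / 2)" if "j \<le> k" for j x
    using that b(1) by (intro order_trans[OF b(2)] mult_right_mono member_le_sum) auto
  then show ?thesis using b(1) by (intro exI[of _ "\<Sum>j\<le>k. b j"]) (auto intro: sum_nonneg)
qed

text \<open>The transition zones have width 1 for every \<open>T\<close>, so derivative bounds do
  not depend on \<open>T\<close>.\<close>

definition cutoff :: "real \<Rightarrow> real \<Rightarrow> real" where
  "cutoff T x = smooth_step (x + (T + 1)) * smooth_step (T + 1 - x)"

lemma smooth_fun_cutoff_factors:
  "smooth_fun (\<lambda>x. smooth_step (x + (T + 1)))" "smooth_fun (\<lambda>x. smooth_step (T + 1 - x))"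
  using smooth_fun_compose[OF smooth_fun_smooth_step smooth_fun_affine[of 1 "T + 1"]]
    smooth_fun_compose[OF smooth_fun_smooth_step smooth_fun_affine[of "- 1" "T + 1"]] by simp_all

lemma smooth_fun_cutoff: "smooth_fun (cutoff T)"
  unfolding cutoff_def[abs_def] by (intro smooth_fun_mult smooth_fun_cutoff_factors)

lemma cutoff_eq_1: "\<bar>x\<bar> \<le> T \<Longrightarrow> cutoff T x = 1"
  by (simp add: cutoff_def smooth_step_eq_1 abs_le_iff)

lemma cutoff_eq_0: "\<bar>x\<bar> \<ge> T + 1 \<Longrightarrow> cutoff T x = 0"
  by (auto simp: cutoff_def smooth_step_eq_0 abs_if split: if_splits)

lemma cutoff_bounds: "0 \<le> cutoff T x" "cutoff T x \<le> 1"
  using smooth_step_bounds by (auto simp: cutoff_def intro!: mult_le_one)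

text \<open>Derivatives of the cutoff factors are translates and reflections of those of
  \<open>smooth_step\<close>, up to sign. Uniformity in \<open>T\<close> is what later frees the
  constant from \<open>n\<close>.\<close>

lemma gauss_cutoff_bounded:
  assumes "\<theta> < 1"
  shows "\<exists>K\<ge>0. \<forall>T. \<forall>j\<le>k. \<forall>x.
    \<bar>(deriv ^^ j) (\<lambda>x. gauss_rho x * cutoff T x) x\<bar> \<le> K * exp (- (\<theta> * x\<^sup>2) / 2)"
proof -
  obtain B where B: "B \<ge> 0" "\<And>j x. j \<le> k \<Longrightarrow> \<bar>(deriv ^^ j) smooth_step x\<bar> \<le> B"
    using iter_derivs_smooth_step_bounded by blast
  obtain K where K: "K \<ge> 0"
      "\<And>j x. j \<le> k \<Longrightarrow> \<bar>(deriv ^^ j) gauss_rho x\<bar> \<le> K * exp (- (\<theta> * x\<^sup>2) / 2)"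
    using iter_derivs_gauss_rho_bounded[OF assms] by blast
  have cut: "\<bar>(deriv ^^ j) (cutoff T) x\<bar> \<le> 2 ^ k * B * B" if "j \<le> k" for j T x
  proof -
    have "\<bar>(deriv ^^ j) (cutoff T) x\<bar> \<le> 2 ^ j * B * B"
      unfolding cutoff_def[abs_def]
    proof (rule iter_deriv_mult_bound)
      fix i assume "i \<le> j"
      then show "\<bar>(deriv ^^ i) (\<lambda>x. smooth_step (x + (T + 1))) x\<bar> \<le> B"
        "\<bar>(deriv ^^ i) (\<lambda>x. smooth_step (T + 1 - x)) x\<bar> \<le> B"
        using that B(2) iter_deriv_affine[OF smooth_fun_smooth_step, of i 1 1 "T + 1"]
          iter_deriv_affine[OF smooth_fun_smooth_step, of i 1 "- 1" "T + 1"]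
        by (simp_all add: abs_mult power_abs)
    qed (rule smooth_fun_cutoff_factors)+
    also have "\<dots> \<le> 2 ^ k * B * B"
      using that B(1) by (intro mult_right_mono power_increasing) auto
    finally show ?thesis .
  qed
  have "\<bar>(deriv ^^ j) (\<lambda>x. gauss_rho x * cutoff T x) x\<bar>
      \<le> (2 ^ k * K * (2 ^ k * B * B)) * exp (- (\<theta> * x\<^sup>2) / 2)" if "j \<le> k" for j T x
  proof -
    have "\<bar>(deriv ^^ j) (\<lambda>x. gauss_rho x * cutoff T x) x\<bar>
        \<le> 2 ^ j * (K * exp (- (\<theta> * x\<^sup>2) / 2)) * (2 ^ k * B * B)"
      using that by (intro iter_deriv_mult_bound smooth_fun_gauss_rho smooth_fun_cutoff K cut) auto
    also have "\<dots> \<le> 2 ^ k * (K * exp (- (\<theta> * x\<^sup>2) / 2)) * (2 ^ k * B * B)"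
      using that B(1) K(1) by (intro mult_right_mono power_increasing) auto
    finally show ?thesis by (simp add: mult_ac)
  qed
  then show ?thesis
    using K(1) B(1) by (intro exI[of _ "2 ^ k * K * (2 ^ k * B * B)"]) auto
qed

lemma test_fun_gauss_cutoff: "test_fun (\<lambda>x. gauss_rho x * cutoff T x)"
proof -
  have "test_fun (cutoff T)"
    unfolding test_fun_iff using smooth_fun_cutoff cutoff_eq_0
    by (auto intro!: exI[of _ "T + 1"] less_imp_le)
  from test_fun_mult[OF this smooth_fun_gauss_rho] show ?thesis by (simp add: mult.commute)
qed

subsection \<open>The trapezoidal error\<close>

lemma sum_lessThan_add:
  fixes u :: "nat \<Rightarrow> 'a::comm_monoid_add"
  shows "(\<Sum>i<m + k. u i) = (\<Sum>i<m. u i) + (\<Sum>i<k. u (m + i))"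
  by (induction k) (simp_all add: add.assoc)

text \<open>The three terms of the bound are the Gaussian tail removed by the cutoff
  (\<open>E2\<close>), the full sum over all nodes compared with the integral of f \<psi>
  (\<open>E1\<close>), and the nodes absent from the trapezoidal rule (\<open>E3\<close>).\<close>

lemma gauss_trapezoid_error:
  fixes \<epsilon> T :: real and n :: nat
  assumes \<epsilon>: "1/2 < \<epsilon>" "\<epsilon> < 1" and \<alpha>: "\<alpha> \<ge> 1"
    and f: "continuous_on UNIV f" and H: "sobolev_H \<alpha> f g"
    and T: "T > 0" and n: "n > 0" and K: "K \<ge> 0"
    and bd: "\<And>j x. j \<le> \<alpha> \<Longrightarrow> \<bar>(deriv ^^ j) (\<lambda>x. gauss_rho x * cutoff T x) x\<bar>
      \<le> K * exp (- ((5/4 - \<epsilon>/2) * x\<^sup>2) / 2)"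
  defines "h \<equiv> 2 * T / real n" and "r \<equiv> exp (- ((1 - \<epsilon>) * T\<^sup>2) / 2)"
  shows "\<bar>gauss_int f - trap_rule n T (\<lambda>x. f x * gauss_rho x)\<bar>
    \<le> gauss_const (1/4 + \<epsilon>/2) * sobolev_norm \<alpha> g
      * (r + 2 ^ (\<alpha> + 1) * K * h ^ \<alpha> + 2 * K * (2 + 3 * h) * r)"
proof -
  define \<beta> where "\<beta> = 1/4 + \<epsilon>/2"
  define \<psi> where "\<psi> = (\<lambda>x. gauss_rho x * cutoff T x)"
  define G where "G = gauss_const \<beta>"
  define S where "S = sobolev_norm \<alpha> g"
  have \<beta>: "\<beta> > 1/2" using \<epsilon> by (simp add: \<beta>_def)
  have G: "G \<ge> 0" and S: "S \<ge> 0" by (simp_all add: G_def gauss_const_nonneg S_def sobolev_norm_nonneg)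
  have r: "r > 0" by (simp add: r_def)
  have h: "h > 0" and nh: "real n * h = 2 * T" using T n by (auto simp: h_def)
  have \<psi>: "test_fun \<psi>" unfolding \<psi>_def by (rule test_fun_gauss_cutoff)
  have L2: "in_L2rho f" using H by (auto simp: sobolev_H_def)
  \<comment> \<open>The exponent splits as
    \<open>5/4 - \<epsilon>/2 = \<beta> + (1 - \<epsilon>)\<close>; for |x| \<ge> T the second part
    contributes at most \<open>r\<close>.\<close>
  have gain: "exp (- ((5/4 - \<epsilon>/2) * x\<^sup>2) / 2) \<le> r * exp (- (\<beta> * x\<^sup>2) / 2)" if "\<bar>x\<bar> \<ge> T" for x
  proof -
    have "T\<^sup>2 \<le> x\<^sup>2" using that T by (simp flip: abs_le_square_iff)
    then have "(1 - \<epsilon>) * T\<^sup>2 \<le> (1 - \<epsilon>) * x\<^sup>2" using \<epsilon> by (intro mult_left_mono) auto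
    moreover have "(5/4 - \<epsilon>/2) * x\<^sup>2 = \<beta> * x\<^sup>2 + (1 - \<epsilon>) * x\<^sup>2"
      by (simp add: \<beta>_def algebra_simps)
    moreover have "- z / 2 \<le> - u / 2 + - w / 2" if "u \<le> v" "z = w + v" for u v w z :: real
      using that by simp
    ultimately show ?thesis
      unfolding r_def exp_add[symmetric] exp_le_cancel_iff by blast
  qed
  have bd_all: "\<bar>(deriv ^^ j) \<psi> x\<bar> \<le> K * exp (- (\<beta> * x\<^sup>2) / 2)" if "j \<le> \<alpha>" for j x
  proof -
    have "\<beta> * x\<^sup>2 \<le> (5/4 - \<epsilon>/2) * x\<^sup>2" using \<epsilon> by (intro mult_right_mono) (auto simp: \<beta>_def)
    then show ?thesis
      using K by (intro order_trans[OF bd[OF that, folded \<psi>_def]] mult_left_mono) auto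
  qed
  \<comment> \<open>The ray from \<open>a\<close> points away from the origin, so all of it
    satisfies |x| \<ge> T and \<open>gain\<close> supplies the factor \<open>r\<close>.\<close>
  have point: "\<bar>f a * \<psi> a\<bar> \<le> 2 * (K * r * G * S)" if "\<bar>a\<bar> \<ge> T" for a
    unfolding G_def S_def
  proof (rule sobolev_H_pointwise_bound[OF H \<alpha> f \<psi> \<beta>, of "if a \<ge> 0 then 1 else -1"])
    fix j :: nat and x :: real
    assume "j \<le> 1" and dir: "(if a \<ge> 0 then 1 else -1) * (x - a) \<ge> 0"
    have "\<bar>x\<bar> \<ge> T" using dir that by (auto split: if_splits)
    then have "K * exp (- ((5/4 - \<epsilon>/2) * x\<^sup>2) / 2) \<le> K * (r * exp (- (\<beta> * x\<^sup>2) / 2))"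
      using K by (intro mult_left_mono gain) auto
    then show "\<bar>(deriv ^^ j) \<psi> x\<bar> \<le> K * r * exp (- (\<beta> * x\<^sup>2) / 2)"
      using bd[of j x, folded \<psi>_def] \<open>j \<le> 1\<close> \<alpha> by (simp add: mult.assoc)
  qed (use K r in auto)

  \<comment> \<open>The fewest cells covering a transition zone of width 1. The upper bound
    \<open>1 + h\<close> on \<open>m * h\<close> keeps \<open>h\<close> times the number of extra
    nodes bounded.\<close>
  define m where "m = nat \<lceil>1 / h\<rceil>"
  have m_eq: "real m = of_int \<lceil>1 / h\<rceil>" using h by (simp add: m_def)
  have mh: "real m * h \<ge> 1"
  proof -
    have "1 / h \<le> real m" unfolding m_eq by simp
    then show ?thesis using h by (simp add: field_simps)
  qed
  have mh': "real m * h \<le> 1 + h"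
  proof -
    have "real m \<le> 1 / h + 1" unfolding m_eq by linarith
    then have "real m * h \<le> (1 / h + 1) * h" using h by (intro mult_right_mono) auto
    then show ?thesis using h by (simp add: distrib_right)
  qed
  \<comment> \<open>The cells of length \<open>h\<close> starting at \<open>a\<close> are centred at the nodes; \<open>m\<close> of them on each side,
    and the one centred at \<open>T\<close>, are not used by the trapezoidal rule.\<close>
  define a where "a = - T - real m * h - h / 2"
  define N where "N = m + (n + (m + 1))"
  define p where "p i = a + (real i + 1/2) * h" for i
  have p: "p i = - T + (real i - real m) * h" for i by (simp add: p_def a_def algebra_simps)
  have end_eq: "a + real N * h = T + real m * h + h / 2"
    using nh by (simp add: a_def N_def algebra_simps)
  have E1: "\<bar>integral\<^sup>L lborel (\<lambda>x. f x * \<psi> x) - h * (\<Sum>i<N. f (p i) * \<psi> (p i))\<bar>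
      \<le> 2 ^ \<alpha> * (2 * h ^ \<alpha> * K * G * S)"
    unfolding p_def G_def S_def
  proof (rule sobolev_H_trapezoid_bound[OF H \<alpha> f \<psi> \<beta> h bd_all])
    fix x assume "x \<notin> {a..a + real N * h}"
    then have "x < - T - real m * h - h / 2 \<or> x > T + real m * h + h / 2"
      unfolding end_eq by (auto simp: a_def)
    then have "\<bar>x\<bar> \<ge> T + 1" using mh h by linarith
    then show "\<psi> x = 0" by (simp add: \<psi>_def cutoff_eq_0)
  qed

  have tail: "\<bar>gauss_rho x - \<psi> x\<bar> \<le> r * exp (- (\<beta> * x\<^sup>2) / 2)" for x
  proof (cases "\<bar>x\<bar> \<le> T")
    case True
    then show ?thesis using r by (simp add: \<psi>_def cutoff_eq_1)
  next
    case False
    have "\<bar>gauss_rho x - \<psi> x\<bar> = gauss_rho x * (1 - cutoff T x)"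
      using cutoff_bounds[of T x] gauss_rho_pos[of x]
      by (simp add: \<psi>_def right_diff_distrib mult_le_cancel_left1)
    also have "\<dots> \<le> gauss_rho x * 1"
      using cutoff_bounds[of T x] gauss_rho_pos[of x] by (intro mult_left_mono) auto
    also have "\<dots> \<le> exp (- (x\<^sup>2) / 2)" using gauss_rho_le_exp by simp
    also have "\<dots> \<le> exp (- ((5/4 - \<epsilon>/2) * x\<^sup>2) / 2)"
      using mult_right_mono[of "5/4 - \<epsilon>/2" 1 "x\<^sup>2"] \<epsilon> by simp
    also have "\<dots> \<le> r * exp (- (\<beta> * x\<^sup>2) / 2)" using False by (intro gain) auto
    finally show ?thesis .
  qed
  have meas: "gauss_rho \<in> borel_measurable borel" "\<psi> \<in> borel_measurable borel"
    using smooth_fun_measurable smooth_fun_gauss_rho \<psi> by (auto simp: test_fun_iff)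
  have int\<psi>: "integrable lborel (\<lambda>x. f x * \<psi> x)" by (rule L2rho_test_integrable[OF L2 \<psi>])
  have int_tail: "integrable lborel (\<lambda>x. f x * (gauss_rho x - \<psi> x))"
    and "\<bar>integral\<^sup>L lborel (\<lambda>x. f x * (gauss_rho x - \<psi> x))\<bar> \<le> r * G * L2rho_norm f"
    unfolding G_def
    using L2rho_gauss_bound[OF \<beta> L2 borel_measurable_diff[OF meas] tail] by auto
  moreover have "L2rho_norm f \<le> S"
    using L2rho_norm_le_sobolev_norm[of 0 \<alpha> g] H by (simp add: S_def sobolev_H_def)
  then have "r * G * L2rho_norm f \<le> r * G * S" using r G by (intro mult_left_mono) auto
  moreover have "gauss_int f
      = integral\<^sup>L lborel (\<lambda>x. f x * \<psi> x) + integral\<^sup>L lborel (\<lambda>x. f x * (gauss_rho x - \<psi> x))"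
    unfolding gauss_int_def
    by (subst Bochner_Integration.integral_add[OF int\<psi> int_tail, symmetric]) (simp add: algebra_simps)
  ultimately have E2: "\<bar>gauss_int f - integral\<^sup>L lborel (\<lambda>x. f x * \<psi> x)\<bar> \<le> r * G * S" by simp

  let ?F = "\<lambda>i. f (p i) * \<psi> (p i)"
  have "(\<Sum>i<n. ?F (m + i)) = (\<Sum>j<n. f (h * real j - T) * gauss_rho (h * real j - T))"
  proof (rule sum.cong)
    fix j assume "j \<in> {..<n}"
    have pj: "p (m + j) = h * real j - T" by (simp add: p algebra_simps)
    have "real j * h \<le> real n * h" using \<open>j \<in> {..<n}\<close> h by (intro mult_right_mono) auto
    moreover have "real j * h \<ge> 0" using h by simp
    ultimately have "\<bar>h * real j - T\<bar> \<le> T" using nh by (simp add: abs_le_iff mult.commute)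
    then show "?F (m + j) = f (h * real j - T) * gauss_rho (h * real j - T)"
      by (simp add: pj \<psi>_def cutoff_eq_1)
  qed simp
  then have trap: "trap_rule n T (\<lambda>x. f x * gauss_rho x) = h * (\<Sum>i<n. ?F (m + i))"
    by (simp add: trap_rule_def h_def)
  let ?P = "2 * (K * r * G * S)"
  have "\<bar>\<Sum>i<m. ?F i\<bar> \<le> (\<Sum>i<m. ?P)"
  proof (intro order_trans[OF sum_abs] sum_mono point)
    fix i assume "i \<in> {..<m}"
    then have "(real m - real i) * h \<ge> 0" using h by (intro mult_nonneg_nonneg) auto
    then show "\<bar>p i\<bar> \<ge> T" by (simp add: p algebra_simps)
  qed
  moreover have "\<bar>\<Sum>i<m + 1. ?F (m + (n + i))\<bar> \<le> (\<Sum>i<m + 1. ?P)"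
  proof (intro order_trans[OF sum_abs] sum_mono point)
    fix i assume "i \<in> {..<m + 1}"
    have "p (m + (n + i)) = T + real i * h" using nh by (simp add: p algebra_simps)
    moreover have "real i * h \<ge> 0" using h by simp
    ultimately show "\<bar>p (m + (n + i))\<bar> \<ge> T" by simp
  qed
  ultimately have "\<bar>(\<Sum>i<m. ?F i) + (\<Sum>i<m + 1. ?F (m + (n + i)))\<bar> \<le> (2 * real m + 1) * ?P"
    by (simp add: algebra_simps)
  moreover have "h * (\<Sum>i<N. ?F i) - trap_rule n T (\<lambda>x. f x * gauss_rho x)
      = h * ((\<Sum>i<m. ?F i) + (\<Sum>i<m + 1. ?F (m + (n + i))))"
    unfolding trap N_def sum_lessThan_add[of _ m] sum_lessThan_add[of _ n]
    by (simp add: algebra_simps)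
  ultimately have "\<bar>h * (\<Sum>i<N. ?F i) - trap_rule n T (\<lambda>x. f x * gauss_rho x)\<bar>
      \<le> h * ((2 * real m + 1) * ?P)"
    using h by (simp add: abs_mult)
  \<comment> \<open>With \<open>m * h \<le> 1 + h\<close> the factor is at most 2 (1 + h) + h = 2 +
    3h.\<close>
  also have "\<dots> = (2 * (real m * h) + h) * ?P" by (simp add: algebra_simps)
  also have "\<dots> \<le> (2 + 3 * h) * ?P"
    using mh' K G S r by (intro mult_right_mono) auto
  finally have E3: "\<bar>h * (\<Sum>i<N. ?F i) - trap_rule n T (\<lambda>x. f x * gauss_rho x)\<bar> \<le> (2 + 3 * h) * ?P" .

  have "\<bar>gauss_int f - trap_rule n T (\<lambda>x. f x * gauss_rho x)\<bar>
      \<le> r * G * S + 2 ^ \<alpha> * (2 * h ^ \<alpha> * K * G * S) + (2 + 3 * h) * ?P"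
    using E1 E2 E3 by linarith
  also have "\<dots> = G * S * (r + 2 ^ (\<alpha> + 1) * K * h ^ \<alpha> + 2 * K * (2 + 3 * h) * r)"
    by (simp add: algebra_simps)
  finally show ?thesis by (simp add: G_def S_def \<beta>_def)
qed

text \<open>The choice of \<open>T\<close> balances the errors: \<open>r\<close> becomes
  n^(-\<alpha>), and \<open>h ^ \<alpha>\<close> is of order (ln n)^(\<alpha>/2) / n^\<alpha>.
  Continuity of \<open>f\<close> encodes the continuous representative, whose point values the rule
  samples.\<close>

theorem theorem4p5:
  fixes \<epsilon> :: real and \<alpha> :: nat
  assumes "1/2 < \<epsilon>" and "\<epsilon> < 1" and "\<alpha> \<ge> 1"
  shows "\<exists>C. \<forall>f g (n::nat). continuous_on UNIV f \<longrightarrow> sobolev_H \<alpha> f g \<longrightarrow> n \<ge> 2 \<longrightarrow>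
     \<bar>gauss_int f - trap_rule n (sqrt (2 / (1 - \<epsilon>) * real \<alpha> * ln (real n)))
                                  (\<lambda>x. f x * gauss_rho x)\<bar>
       \<le> C * sobolev_norm \<alpha> g * ln (real n) powr (real \<alpha> / 2 + 1/4) / real n ^ \<alpha>"
proof -
  \<comment> \<open>The exponent \<open>5/4 - \<epsilon>/2\<close> is below 1 because \<epsilon> >
    1/2. \<open>K\<close> is fixed before \<open>f\<close> and \<open>n\<close>.\<close>
  obtain K where K: "K \<ge> 0" "\<And>T j x. j \<le> \<alpha> \<Longrightarrow>
      \<bar>(deriv ^^ j) (\<lambda>x. gauss_rho x * cutoff T x) x\<bar> \<le> K * exp (- ((5/4 - \<epsilon>/2) * x\<^sup>2) / 2)"
    using gauss_cutoff_bounded[of "5/4 - \<epsilon>/2" \<alpha>] assms(1) by auto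
  define A where "A = 2 / (1 - \<epsilon>) * real \<alpha>"
  define G where "G = gauss_const (1/4 + \<epsilon>/2)"
  \<comment> \<open>As ln 2 < 1, powers of ln n can fall below 1; for n \<ge> 2 they stay above the
    powers of ln 2. \<open>c1\<close> compensates in the terms without a logarithm,
    \<open>c2\<close> for the surplus exponent 1/4 in the \<open>h ^ \<alpha>\<close> term.\<close>
  define c1 where "c1 = ln (2::real) powr - (real \<alpha> / 2 + 1/4)"
  define c2 where "c2 = ln (2::real) powr (- 1/4)"
  define D where "D = c1 + 2 ^ (\<alpha> + 1) * K * ((2 * sqrt A) ^ \<alpha> * c2) + 2 * K * (2 + 3 * (2 * sqrt A)) * c1"
  have A: "A > 0" using assms by (simp add: A_def)
  have G: "G \<ge> 0" by (simp add: G_def gauss_const_nonneg)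
  have "\<bar>gauss_int f - trap_rule n (sqrt (A * ln (real n))) (\<lambda>x. f x * gauss_rho x)\<bar>
      \<le> G * D * sobolev_norm \<alpha> g * ln (real n) powr (real \<alpha> / 2 + 1/4) / real n ^ \<alpha>"
    if f: "continuous_on UNIV f" and H: "sobolev_H \<alpha> f g" and n: "n \<ge> 2" for f g and n :: nat
  proof -
    define L where "L = ln (real n)"
    define T where "T = sqrt (A * L)"
    define h where "h = 2 * T / real n"
    define r where "r = exp (- ((1 - \<epsilon>) * T\<^sup>2) / 2)"
    define P where "P = L powr (real \<alpha> / 2 + 1/4)"
    define S where "S = sobolev_norm \<alpha> g"
    have ln2: "ln 2 > (0::real)" by simp
    have L2: "L \<ge> ln 2" using n by (simp add: L_def)
    have L: "L > 0" using ln2 L2 by linarith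
    have P: "P > 0" using L by (simp add: P_def)
    have S: "S \<ge> 0" by (simp add: S_def sobolev_norm_nonneg)
    have T: "T > 0" using A L by (simp add: T_def)
    have n0: "real n > 0" using n by simp
    have "(1 - \<epsilon>) * T\<^sup>2 / 2 = real \<alpha> * L"
      using A L assms(2) by (simp add: T_def A_def field_simps)
    then have "r = exp (- (real \<alpha> * ln (real n)))" by (simp add: r_def L_def)
    then have r: "r = 1 / real n ^ \<alpha>"
      using n0 by (simp add: exp_minus exp_of_nat_mult inverse_eq_divide)
    have "1 \<le> c1 * P"
    proof -
      have "1 = c1 * ln 2 powr (real \<alpha> / 2 + 1/4)"
        unfolding c1_def by (simp flip: powr_add)
      also have "\<dots> \<le> c1 * P"
        unfolding P_def using L2 by (intro mult_left_mono powr_mono2) (auto simp: c1_def)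
      finally show ?thesis .
    qed
    then have rP: "r \<le> c1 * (P / real n ^ \<alpha>)" using n0 by (simp add: r field_simps)
    have TL: "T = sqrt A * sqrt L" by (simp add: T_def real_sqrt_mult)
    have "sqrt L ^ \<alpha> = L powr (real \<alpha> / 2)"
      using L by (simp add: powr_half_sqrt[symmetric] powr_powr flip: powr_realpow)
    also have "\<dots> = L powr (- 1/4) * P"
      unfolding P_def by (simp flip: powr_add)
    also have "\<dots> \<le> c2 * P"
      unfolding c2_def using L2 P by (intro mult_right_mono powr_mono2') auto
    finally have sqrtL: "sqrt L ^ \<alpha> \<le> c2 * P" .
    have "h ^ \<alpha> = (2 * sqrt A) ^ \<alpha> * sqrt L ^ \<alpha> / real n ^ \<alpha>"
      by (simp add: h_def TL power_divide power_mult_distrib)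
    also have "\<dots> \<le> (2 * sqrt A) ^ \<alpha> * (c2 * P) / real n ^ \<alpha>"
      using A by (intro divide_right_mono mult_left_mono sqrtL) auto
    finally have hP: "h ^ \<alpha> \<le> (2 * sqrt A) ^ \<alpha> * c2 * (P / real n ^ \<alpha>)" by simp
    \<comment> \<open>A crude bound on \<open>h\<close>, uniform in \<open>n\<close>, suffices here
      because the factor \<open>2 + 3 * h\<close> is multiplied by \<open>r\<close>, which already
      has the full rate.\<close>
    have "L \<le> real n" using ln_le_minus_one[OF n0] by (simp add: L_def)
    also have "\<dots> \<le> (real n)\<^sup>2" using n by (simp add: power2_eq_square)
    finally have "sqrt L \<le> real n" by (intro real_le_lsqrt) auto
    then have "h \<le> 2 * sqrt A" using A n0 by (simp add: h_def TL field_simps mult_left_mono)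
    then have h3: "2 * K * (2 + 3 * h) \<le> 2 * K * (2 + 3 * (2 * sqrt A))"
      using K(1) by (intro mult_left_mono) auto
    have "r + 2 ^ (\<alpha> + 1) * K * h ^ \<alpha> + 2 * K * (2 + 3 * h) * r
        \<le> c1 * (P / real n ^ \<alpha>)
          + 2 ^ (\<alpha> + 1) * K * ((2 * sqrt A) ^ \<alpha> * c2 * (P / real n ^ \<alpha>))
          + 2 * K * (2 + 3 * (2 * sqrt A)) * (c1 * (P / real n ^ \<alpha>))"
      using K(1) A by (intro add_mono mult_mono[OF h3 rP] mult_left_mono[OF hP] rP) (auto simp: r)
    also have "\<dots> = D * (P / real n ^ \<alpha>)" by (simp add: D_def algebra_simps)
    finally have "G * S * (r + 2 ^ (\<alpha> + 1) * K * h ^ \<alpha> + 2 * K * (2 + 3 * h) * r)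
        \<le> G * S * (D * (P / real n ^ \<alpha>))"
      using G S by (intro mult_left_mono) auto
    moreover have "\<bar>gauss_int f - trap_rule n T (\<lambda>x. f x * gauss_rho x)\<bar>
        \<le> G * S * (r + 2 ^ (\<alpha> + 1) * K * h ^ \<alpha> + 2 * K * (2 + 3 * h) * r)"
      unfolding G_def S_def h_def r_def
      using n by (intro gauss_trapezoid_error[OF assms f H T _ K]) auto
    ultimately show ?thesis by (simp add: T_def L_def P_def S_def mult_ac)
  qed
  then show ?thesis by (intro exI[of _ "G * D"]) (simp add: A_def)
qed

end
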